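(* Let $W$ be a weight satisfying $(C_1)$, $(C_2)$ and $(C_3)$, and let $\{\omega(n)\}_{n\geq 0}$ be its associated moment sequence. If a compact set $E\subset \mathbb{T}$ supports a non-trivial (finite complex Borel) measure $\mu$ whose positive frequencies satisfy $$\sum_{n > 0} |\widehat{\mu}(n)|^2 \omega(n) < \infty,$$ then $E$ also supports a probability measure $\nu$ with $\{\widehat{\nu}(n)\}_{n\in \mathbb{Z}} \in \ell^2(\omega)$, i.e. with $\sum_{n\in\mathbb{Z}}|\widehat\nu(n)|^2\omega(|n|)<\infty$.
   Context: $\mathbb{T}$ is the unit circle. A weight is a non-negative continuously differentiable function $W$ on $(0,1]$ which is integrable on $[0,1]$ with respect to Lebesgue measure. Its associated moment sequence is $\omega(n)=\int_0^1 r^n W(1-r)\,dr$, $n=0,1,2,\dots$. The conditions on $W$ are: $(C_1)$ $W$ is either monotone non-decreasing or monotone non-increasing; $(C_2)$ $\int_0^1 \frac{W(t)}{t}\,dt=+\infty$; $(C_3)$ there is a constant $0<c<2$, depending only on $W$, such that $W(t)\leq c\,W(t/2)$ for all $0<t<1$. The Fourier coefficients of a finite Borel measure $\mu$ on $\mathbb{T}$ are $\widehat\mu(n)=\int_{\mathbb{T}}\zeta^{-n}d\mu(\zeta)$. A set $E$ supports a measure if the support of the measure is contained in $E$. $\ell^2(\omega)$ denotes the space of two-sided sequences $\{a_n\}_{n\in\mathbb{Z}}$ with $\sum_n|a_n|^2\omega(|n|)<\infty$. *)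

theory Defs
  imports "HOL-Probability.Probability_Measure"
begin

section \<open>Complex measures\<close>

definition complex_measure :: "'a measure \<Rightarrow> ('a set \<Rightarrow> complex) \<Rightarrow> bool" where
  "complex_measure M \<mu> \<longleftrightarrow>
     (\<forall>A :: nat \<Rightarrow> 'a set. range A \<subseteq> sets M \<longrightarrow> disjoint_family A \<longrightarrow>
        (\<lambda>n. \<mu> (A n)) sums \<mu> (\<Union>n. A n))"

definition total_variation :: "'a measure \<Rightarrow> ('a set \<Rightarrow> complex) \<Rightarrow> 'a set \<Rightarrow> ennreal" where
  "total_variation M \<mu> A =
     (SUP P \<in> {P :: nat \<Rightarrow> 'a set. range P \<subseteq> sets M \<and> disjoint_family P \<and> (\<Union>n. P n) = A}.
        \<Sum>n. ennreal (norm (\<mu> (P n))))"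

text \<open>The positive part \<open>\<sigma>\<^sup>+(A) = sup {\<sigma>(B) | B \<subseteq> A}\<close> of the Jordan decomposition of a finite
  signed measure \<open>\<sigma>\<close>; the negative part is the positive part of \<open>-\<sigma>\<close>.  The truncation of
  negative values by \<open>ennreal\<close> is harmless, since \<open>B = {}\<close> is admissible.
  The function is countably additive, see \<open>emeasure_positive_part\<close>.\<close>

definition positive_part :: "'a measure \<Rightarrow> ('a set \<Rightarrow> real) \<Rightarrow> 'a measure" where
  "positive_part M \<sigma> = measure_of (space M) (sets M)
     (\<lambda>A. SUP B \<in> {B \<in> sets M. B \<subseteq> A}. ennreal (\<sigma> B))"

definition complex_measure_integral ::
    "'a measure \<Rightarrow> ('a set \<Rightarrow> complex) \<Rightarrow> ('a \<Rightarrow> complex) \<Rightarrow> complex" where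
  "complex_measure_integral M \<mu> f =
     ((LINT x|positive_part M (\<lambda>A. Re (\<mu> A)). f x) - (LINT x|positive_part M (\<lambda>A. - Re (\<mu> A)). f x))
     + \<i> * ((LINT x|positive_part M (\<lambda>A. Im (\<mu> A)). f x) - (LINT x|positive_part M (\<lambda>A. - Im (\<mu> A)). f x))"

lemma emeasure_positive_part:
  assumes \<sigma>: "\<And>A :: nat \<Rightarrow> 'a set. range A \<subseteq> sets M \<Longrightarrow> disjoint_family A \<Longrightarrow>
                (\<lambda>n. \<sigma> (A n)) sums \<sigma> (\<Union>n. A n)"
    and A: "A \<in> sets M"
  shows "emeasure (positive_part M \<sigma>) A = (SUP B \<in> {B \<in> sets M. B \<subseteq> A}. ennreal (\<sigma> B))"
proof -
  define p where "p A = (SUP B \<in> {B \<in> sets M. B \<subseteq> A}. ennreal (\<sigma> B))" for A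
  have \<sigma>0: "\<sigma> {} = 0"
  proof -
    have "summable (\<lambda>_::nat. \<sigma> {})"
      using \<sigma>[of "\<lambda>_. {}"] by (auto simp: disjoint_family_on_def intro: sums_summable)
    then show ?thesis by (simp add: summable_const_iff)
  qed
  have p0: "p {} = 0"
    using \<sigma>0 by (auto simp: p_def intro!: antisym SUP_least)
  have upper: "ennreal (\<sigma> B) \<le> p A" if "B \<in> sets M" "B \<subseteq> A" for A B
    using that unfolding p_def by (auto intro: SUP_upper)
  have pmono: "p A \<le> p B" if "A \<subseteq> B" for A B
    using that unfolding p_def by (auto intro!: SUP_subset_mono)
  have add: "\<sigma> (B \<union> C) = \<sigma> B + \<sigma> C" if "B \<in> sets M" "C \<in> sets M" "B \<inter> C = {}" for B C
  proof -
    have "(\<lambda>n. \<sigma> (binaryset B C n)) sums \<sigma> (\<Union>n. binaryset B C n)"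
      using that by (intro \<sigma>) (auto simp: range_binaryset_eq disjoint_family_on_def binaryset_def)
    moreover have "(\<lambda>n. \<sigma> (binaryset B C n)) sums (\<sigma> B + \<sigma> C)"
      by (rule binaryset_sums) (simp add: \<sigma>0)
    ultimately show ?thesis by (simp add: UN_binaryset_eq sums_unique2)
  qed
  have super: "p A + p C \<le> p (A \<union> C)" if "A \<inter> C = {}" for A C
  proof -
    have ne: "{B \<in> sets M. B \<subseteq> X} \<noteq> {}" for X by auto
    have 1: "ennreal (\<sigma> B) + ennreal (\<sigma> D) \<le> p (A \<union> C)"
      if B: "B \<in> sets M" "B \<subseteq> A" and D: "D \<in> sets M" "D \<subseteq> C" for B D
    proof -
      consider "\<sigma> B \<ge> 0 \<and> \<sigma> D \<ge> 0" | "\<sigma> B < 0" | "\<sigma> D < 0" by linarith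
      then show ?thesis
      proof cases
        case 1
        have "\<sigma> (B \<union> D) = \<sigma> B + \<sigma> D"
          using B D \<open>A \<inter> C = {}\<close> by (intro add) auto
        then show ?thesis using 1 B D upper[of "B \<union> D" "A \<union> C"]
          by (auto simp: ennreal_plus)
      next
        case 2 then show ?thesis using D upper[of D "A \<union> C"] by (auto simp: ennreal_neg)
      next
        case 3 then show ?thesis using B upper[of B "A \<union> C"] by (auto simp: ennreal_neg)
      qed
    qed
    have "p A + p C = (SUP B \<in> {B \<in> sets M. B \<subseteq> A}. ennreal (\<sigma> B) + p C)"
      unfolding p_def[of A] by (rule ennreal_SUP_add_left[symmetric, OF ne])
    also have "\<dots> \<le> p (A \<union> C)"
    proof (rule SUP_least)
      fix B assume B: "B \<in> {B \<in> sets M. B \<subseteq> A}"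
      have "ennreal (\<sigma> B) + p C = (SUP D \<in> {B \<in> sets M. B \<subseteq> C}. ennreal (\<sigma> B) + ennreal (\<sigma> D))"
        unfolding p_def[of C] by (rule ennreal_SUP_add_right[OF ne])
      also have "\<dots> \<le> p (A \<union> C)" using B 1 by (auto intro!: SUP_least)
      finally show "ennreal (\<sigma> B) + p C \<le> p (A \<union> C)" .
    qed
    finally show ?thesis .
  qed
  have "countably_additive (sets M) p"
  proof (rule countably_additiveI)
    fix A :: "nat \<Rightarrow> 'a set"
    assume A: "range A \<subseteq> sets M" "disjoint_family A" "(\<Union>i. A i) \<in> sets M"
    have "(\<Sum>i<n. p (A i)) \<le> p (\<Union>i<n. A i)" for n
    proof (induction n)
      case (Suc n)
      have "(\<Sum>i<Suc n. p (A i)) \<le> p (\<Union>i<n. A i) + p (A n)"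
        using Suc by (simp add: add_right_mono)
      also have "\<dots> \<le> p ((\<Union>i<n. A i) \<union> A n)"
        proof (rule super)
        show "(\<Union>i<n. A i) \<inter> A n = {}"
          using A(2) by (auto simp: disjoint_family_on_def dest: less_imp_neq)
      qed
      also have "(\<Union>i<n. A i) \<union> A n = (\<Union>i<Suc n. A i)" by (auto simp: less_Suc_eq)
      finally show ?case .
    qed (simp add: p0)
    moreover have "p (\<Union>i<n. A i) \<le> p (\<Union>i. A i)" for n by (intro pmono) auto
    ultimately have "(\<Sum>i. p (A i)) \<le> p (\<Union>i. A i)"
      by (intro suminf_le_const) (blast intro: order_trans summableI)+
    moreover have "p (\<Union>i. A i) \<le> (\<Sum>i. p (A i))"
      unfolding p_def[of "\<Union>i. A i"]
    proof (rule SUP_least)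
      fix B assume B: "B \<in> {B \<in> sets M. B \<subseteq> (\<Union>i. A i)}"
      have "(\<lambda>n. \<sigma> (B \<inter> A n)) sums \<sigma> (\<Union>n. B \<inter> A n)"
        using A B by (intro \<sigma>) (auto simp: disjoint_family_on_def)
      moreover have "(\<Union>n. B \<inter> A n) = B" using B by auto
      ultimately have "(\<lambda>n. \<Sum>i<n. \<sigma> (B \<inter> A i)) \<longlonglongrightarrow> \<sigma> B" by (simp add: sums_def)
      then have "(\<lambda>n. ennreal (\<Sum>i<n. \<sigma> (B \<inter> A i))) \<longlonglongrightarrow> ennreal (\<sigma> B)" by (rule tendsto_ennrealI)
      moreover have "ennreal (\<Sum>i<n. \<sigma> (B \<inter> A i)) \<le> (\<Sum>i. p (A i))" for n
      proof -
        have "ennreal (\<Sum>i<n. \<sigma> (B \<inter> A i)) \<le> ennreal (\<Sum>i<n. max 0 (\<sigma> (B \<inter> A i)))"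
          by (intro ennreal_leI sum_mono) auto
        also have "\<dots> = (\<Sum>i<n. ennreal (max 0 (\<sigma> (B \<inter> A i))))" by (rule sum_ennreal[symmetric]) auto
        also have "\<dots> \<le> (\<Sum>i<n. p (A i))"
        proof (rule sum_mono)
          fix i
          have "ennreal (\<sigma> (B \<inter> A i)) \<le> p (A i)" using A B by (intro upper) auto
          then show "ennreal (max 0 (\<sigma> (B \<inter> A i))) \<le> p (A i)" by (simp add: max_def ennreal_neg)
        qed
        also have "\<dots> \<le> (\<Sum>i. p (A i))" by (intro sum_le_suminf) auto
        finally show ?thesis .
      qed
      ultimately show "ennreal (\<sigma> B) \<le> (\<Sum>i. p (A i))" by - (rule LIMSEQ_le_const2, assumption, simp)
    qed
    ultimately show "(\<Sum>i. p (A i)) = p (\<Union>i. A i)" by (rule antisym)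
  qed
  moreover have "positive (sets M) p" by (simp add: positive_def p0)
  moreover have "positive_part M \<sigma> = measure_of (space M) (sets M) p"
    by (simp add: positive_part_def p_def[abs_def])
  ultimately show ?thesis
    using A by (simp add: emeasure_measure_of_sigma sets.sigma_algebra_axioms p_def)
qed

section \<open>Measures on the unit circle\<close>

abbreviation unit_circle :: "complex set" where
  "unit_circle \<equiv> sphere 0 1"

abbreviation circle_borel :: "complex measure" where
  "circle_borel \<equiv> restrict_space borel unit_circle"

definition complex_support :: "(complex set \<Rightarrow> complex) \<Rightarrow> complex set" where
  "complex_support \<mu> = {z \<in> unit_circle. \<forall>U. open U \<longrightarrow> z \<in> U \<longrightarrow>
     total_variation circle_borel \<mu> (U \<inter> unit_circle) \<noteq> 0}"

definition measure_support :: "complex measure \<Rightarrow> complex set" where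
  "measure_support \<nu> = {z \<in> unit_circle. \<forall>U. open U \<longrightarrow> z \<in> U \<longrightarrow>
     emeasure \<nu> (U \<inter> unit_circle) \<noteq> 0}"

definition complex_fourier_coeff :: "(complex set \<Rightarrow> complex) \<Rightarrow> int \<Rightarrow> complex" where
  "complex_fourier_coeff \<mu> n = complex_measure_integral circle_borel \<mu> (\<lambda>z. z powi (-n))"

definition fourier_coeff :: "complex measure \<Rightarrow> int \<Rightarrow> complex" where
  "fourier_coeff \<nu> n = (LINT z|\<nu>. z powi (-n))"

definition weighted_l2 :: "(nat \<Rightarrow> real) \<Rightarrow> (int \<Rightarrow> complex) set" where
  "weighted_l2 \<omega> = {a. (\<lambda>n. (norm (a n))\<^sup>2 * \<omega> (nat \<bar>n\<bar>)) summable_on UNIV}"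

section \<open>Weights\<close>

text \<open>Weights live on \<open>(0,1]\<close>; at the endpoint \<open>1\<close> the derivative is one-sided.\<close>

definition weight :: "(real \<Rightarrow> real) \<Rightarrow> bool" where
  "weight W \<longleftrightarrow>
     (\<forall>t\<in>{0<..1}. 0 \<le> W t) \<and>
     (\<exists>W'. continuous_on {0<..1} W' \<and>
        (\<forall>t\<in>{0<..1}. (W has_real_derivative W' t) (at t within {0<..1}))) \<and>
     set_integrable lborel {0<..1} W"

definition moment :: "(real \<Rightarrow> real) \<Rightarrow> nat \<Rightarrow> real" where
  "moment W n = (LBINT r:{0..<1}. r ^ n * W (1 - r))"

definition condition_C1 :: "(real \<Rightarrow> real) \<Rightarrow> bool" where
  "condition_C1 W \<longleftrightarrow> mono_on {0<..1} W \<or> antimono_on {0<..1} W"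

definition condition_C2 :: "(real \<Rightarrow> real) \<Rightarrow> bool" where
  "condition_C2 W \<longleftrightarrow> (\<integral>\<^sup>+t\<in>{0<..1}. ennreal (W t / t) \<partial>lborel) = \<infinity>"

definition condition_C3 :: "(real \<Rightarrow> real) \<Rightarrow> bool" where
  "condition_C3 W \<longleftrightarrow> (\<exists>c. 0 < c \<and> c < 2 \<and> (\<forall>t. 0 < t \<and> t < 1 \<longrightarrow> W t \<le> c * W (t / 2)))"

end

theory Submission
  imports Defs "HOL-Probability.Probability" "HOL-Complex_Analysis.Complex_Analysis"
begin

text \<open>
  Suppose that no probability measure on \<open>E\<close> has finite energy
  \<open>\<Sum>n. |\<nu>^(n)|\<^sup>2 \<omega>(|n|)\<close>.  By weak compactness the regularized energies, with weights
  \<open>\<omega>(|n|) r^|n|\<close>, of probability measures on \<open>E\<close> get uniformly large as \<open>r\<close> tends to 1.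
  An almost extremal measure then has a potential that, suitably normalized, is the real part of a
  power series \<open>h\<close> with \<open>Re h \<ge> 1\<close> on \<open>E\<close>, \<open>Re h \<ge> 0\<close> on the disc (the kernel is an average
  of Poisson kernels), and small norm \<open>\<Sum>n>0. |h\<^sub>n|\<^sup>2 / \<omega>(n)\<close>.  By \<open>(C\<^sub>3)\<close> this norm is
  equivalent to a weighted area integral of \<open>|h'|\<^sup>2\<close>, so that passing to \<open>g = exp (-A h)\<close>,
  where \<open>|g'| \<le> A |h'|\<close>, keeps it small.  As \<open>|g| \<le> exp (-A)\<close> on \<open>E\<close>, pairing the conjugate
  of \<open>g\<close> times \<open>\<zeta>^(-k)\<close> with \<open>\<mu>\<close>, which only involves the frequencies of \<open>\<mu>\<close> from \<open>k\<close> on, shows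
  \<open>\<mu>^(k) = 0\<close> for every integer \<open>k\<close>, so \<open>\<mu> = 0\<close>.
\<close>

text \<open>The hypothesis controls one half of the frequencies, so a test function paired with
  \<open>\<mu>\<close> must have a one-sided expansion, and a real cut-off near \<open>E\<close>
  would bring in frequencies of the wrong sign. Exponentiation stays within power series; its price
  is the factor A in the derivative and the constant term exp(-A h(0)). The parameters balance
  these: with A = N and energies at least N^4, the value on \<open>E\<close> is exp(-N), the dual
  norm of g - g(0) is O(N / N^2) = O(1/N), and A h(0) = O(N^(-3)), so g(0) tends to 1 while the
  other terms vanish.

  The regularization r < 1 makes all series converge on a disc of radius greater than 1, so they can
  be evaluated and differentiated termwise on the unit circle. It also lets finitely supported
  measures stand for all measures until the weak limit is taken.

  \<open>condition_C2\<close> enters through positivity of the moments. \<open>condition_C3\<close>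
  enters twice: as geometric decay in a dyadic version of the area integral, and in moving the
  summability hypothesis to shifted frequencies. The shift is essential, since g(0) isolates a
  single coefficient of \<open>\<mu>\<close>.\<close>

section \<open>Jordan decomposition of complex measures\<close>

text \<open>The condition in \<open>complex_measure\<close> for values in any normed space, so that
  the same lemmas serve a complex measure and its real components.\<close>

definition countably_additive_on :: "'a measure \<Rightarrow> ('a set \<Rightarrow> 'b::real_normed_vector) \<Rightarrow> bool" where
  "countably_additive_on M \<sigma> \<longleftrightarrow>
     (\<forall>A :: nat \<Rightarrow> 'a set. range A \<subseteq> sets M \<longrightarrow> disjoint_family A \<longrightarrow>
        (\<lambda>n. \<sigma> (A n)) sums \<sigma> (\<Union>n. A n))"

lemma countably_additive_onD:
  assumes "countably_additive_on M \<sigma>" "range A \<subseteq> sets M" "disjoint_family A"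
  shows "(\<lambda>n. \<sigma> (A n)) sums \<sigma> (\<Union>n. A n)"
  using assms by (auto simp: countably_additive_on_def)

lemma countably_additive_on_empty:
  assumes "countably_additive_on M \<sigma>"
  shows "\<sigma> {} = 0"
proof -
  have "summable (\<lambda>_::nat. \<sigma> {})"
    using countably_additive_onD[OF assms, of "\<lambda>_. {}"]
    by (auto simp: disjoint_family_on_def intro: sums_summable)
  then show ?thesis by (simp add: summable_const_iff)
qed

lemma countably_additive_on_Un:
  assumes \<sigma>: "countably_additive_on M \<sigma>" and "B \<in> sets M" "C \<in> sets M" "B \<inter> C = {}"
  shows "\<sigma> (B \<union> C) = \<sigma> B + \<sigma> C"
proof -
  have "(\<lambda>n. \<sigma> (binaryset B C n)) sums \<sigma> (\<Union>n. binaryset B C n)"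
    using assms by (intro countably_additive_onD[OF \<sigma>])
      (auto simp: range_binaryset_eq disjoint_family_on_def binaryset_def)
  moreover have "(\<lambda>n. \<sigma> (binaryset B C n)) sums (\<sigma> B + \<sigma> C)"
    by (rule binaryset_sums) (simp add: countably_additive_on_empty[OF \<sigma>])
  ultimately show ?thesis by (simp add: UN_binaryset_eq sums_unique2)
qed

lemma countably_additive_on_Diff:
  assumes \<sigma>: "countably_additive_on M \<sigma>" and "A \<in> sets M" "B \<in> sets M" "B \<subseteq> A"
  shows "\<sigma> A = \<sigma> B + \<sigma> (A - B)"
  using countably_additive_on_Un[OF \<sigma>, of B "A - B"] assms by (simp add: Un_absorb1)

text \<open>If the values were unbounded, one could keep splitting off pieces of norm greater than 1
  from a set that still has subsets of arbitrarily large norm. The pieces are disjoint, so their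
  values would form a convergent series whose terms do not tend to 0.\<close>

lemma countably_additive_on_bounded:
  fixes \<sigma> :: "'a set \<Rightarrow> 'b::real_normed_vector"
  assumes \<sigma>: "countably_additive_on M \<sigma>"
  shows "\<exists>C. \<forall>B\<in>sets M. norm (\<sigma> B) \<le> C"
proof (rule ccontr)
  define bdd where "bdd A \<longleftrightarrow> (\<exists>C. \<forall>B\<in>sets M. B \<subseteq> A \<longrightarrow> norm (\<sigma> B) \<le> C)" for A
  assume neg: "\<not> ?thesis"
  have nb: "\<not> bdd (space M)"
  proof
    assume "bdd (space M)"
    then obtain C where "\<And>B. B \<in> sets M \<Longrightarrow> norm (\<sigma> B) \<le> C"
      unfolding bdd_def using sets.sets_into_space by metis
    with neg show False by blast
  qed
  have split: "\<exists>A'. A' \<in> sets M \<and> \<not> bdd A' \<and> A' \<subseteq> A \<and> 1 < norm (\<sigma> (A - A'))"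
    if A: "A \<in> sets M" "\<not> bdd A" for A
  proof -
    \<comment> \<open>The margin norm (\<sigma> A) + 1 makes both B and A - B exceed 1 in norm, so
      whichever of them is still unbounded may be kept and the other discarded.\<close>
    obtain B where B: "B \<in> sets M" "B \<subseteq> A" "norm (\<sigma> B) > norm (\<sigma> A) + 1"
      using A(2) unfolding bdd_def by (meson linorder_not_le)
    have eq: "\<sigma> A = \<sigma> B + \<sigma> (A - B)"
      using countably_additive_on_Diff[OF \<sigma>] A B by blast
    have "norm (\<sigma> B) \<le> norm (\<sigma> A) + norm (\<sigma> (A - B))"
      using norm_triangle_ineq4[of "\<sigma> A" "\<sigma> (A - B)"] by (simp add: eq)
    then have big: "1 < norm (\<sigma> (A - B))" "1 < norm (\<sigma> B)"
      using B(3) norm_ge_zero[of "\<sigma> A"] by linarith+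
    have "\<not> bdd B \<or> \<not> bdd (A - B)"
    proof (rule ccontr)
      assume "\<not> ?thesis"
      then have bdd: "bdd B" "bdd (A - B)" by simp_all
      obtain C where C: "\<And>X. X \<in> sets M \<Longrightarrow> X \<subseteq> B \<Longrightarrow> norm (\<sigma> X) \<le> C"
        using bdd(1) unfolding bdd_def by metis
      obtain D where D: "\<And>X. X \<in> sets M \<Longrightarrow> X \<subseteq> A - B \<Longrightarrow> norm (\<sigma> X) \<le> D"
        using bdd(2) unfolding bdd_def by metis
      have "norm (\<sigma> X) \<le> C + D" if X: "X \<in> sets M" "X \<subseteq> A" for X
      proof -
        have "\<sigma> X = \<sigma> (X \<inter> B) + \<sigma> (X - X \<inter> B)"
          using X B by (intro countably_additive_on_Diff[OF \<sigma>]) auto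
        moreover have "norm (\<sigma> (X \<inter> B)) \<le> C"
          using X B by (intro C) auto
        moreover have "norm (\<sigma> (X - X \<inter> B)) \<le> D"
          using X B by (intro D) auto
        ultimately show ?thesis
          using norm_triangle_ineq[of "\<sigma> (X \<inter> B)" "\<sigma> (X - X \<inter> B)"] by simp
      qed
      with A(2) show False unfolding bdd_def by blast
    qed
    then show ?thesis
    proof
      assume "\<not> bdd B"
      then show ?thesis using B big by blast
    next
      assume "\<not> bdd (A - B)"
      moreover have "A - (A - B) = B" using B by blast
      ultimately show ?thesis using A B big by (intro exI[of _ "A - B"]) auto
    qed
  qed
  have "\<exists>F. \<forall>n::nat. (F n \<in> sets M \<and> \<not> bdd (F n)) \<and>
            (F (Suc n) \<subseteq> F n \<and> 1 < norm (\<sigma> (F n - F (Suc n))))"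
    by (rule dependent_nat_choice[where P = "\<lambda>_ X. X \<in> sets M \<and> \<not> bdd X"
          and Q = "\<lambda>_ X Y. Y \<subseteq> X \<and> 1 < norm (\<sigma> (X - Y))"]) (use nb split in blast)+
  then obtain F where F: "\<And>n. F n \<in> sets M" "\<And>n. F (Suc n) \<subseteq> F n"
    "\<And>n. 1 < norm (\<sigma> (F n - F (Suc n)))" by auto
  have dec: "decseq F" using F(2) by (rule decseq_SucI)
  have disj: "disjoint_family (\<lambda>n. F n - F (Suc n))"
    unfolding disjoint_family_on_def
  proof (intro ballI impI)
    fix m n :: nat assume "m \<noteq> n"
    then show "(F m - F (Suc m)) \<inter> (F n - F (Suc n)) = {}"
      using dec[THEN decseqD, of "Suc m" n] dec[THEN decseqD, of "Suc n" m]
      by (cases m n rule: linorder_cases) (auto simp: Suc_le_eq)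
  qed
  have "(\<lambda>n. \<sigma> (F n - F (Suc n))) sums \<sigma> (\<Union>n. F n - F (Suc n))"
    using F(1) disj by (intro countably_additive_onD[OF \<sigma>]) auto
  then have "(\<lambda>n. norm (\<sigma> (F n - F (Suc n)))) \<longlonglongrightarrow> 0"
    by (intro tendsto_norm_zero summable_LIMSEQ_zero sums_summable)
  then have "(1::real) \<le> 0"
    using F(3) by (intro LIMSEQ_le_const) (auto intro: less_imp_le)
  then show False by simp
qed


lemma space_positive_part [simp]: "space (positive_part M \<sigma>) = space M"
  and sets_positive_part [simp]: "sets (positive_part M \<sigma>) = sets M"
  by (simp_all add: positive_part_def)

section \<open>The positive part of a real countably additive set function\<close>

context
  fixes M :: "'a measure" and \<sigma> :: "'a set \<Rightarrow> real"
  assumes \<sigma>: "countably_additive_on M \<sigma>"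
begin

lemma emeasure_positive_part':
  "A \<in> sets M \<Longrightarrow> emeasure (positive_part M \<sigma>) A = (SUP B \<in> {B \<in> sets M. B \<subseteq> A}. ennreal (\<sigma> B))"
  using \<sigma> by (intro emeasure_positive_part) (auto simp: countably_additive_on_def)

lemma finite_measure_positive_part: "finite_measure (positive_part M \<sigma>)"
proof
  obtain C where C: "\<And>B. B \<in> sets M \<Longrightarrow> norm (\<sigma> B) \<le> C"
    using countably_additive_on_bounded[OF \<sigma>] by blast
  have "emeasure (positive_part M \<sigma>) (space M) \<le> ennreal C"
    unfolding emeasure_positive_part'[OF sets.top]
  proof (rule SUP_least)
    fix B assume "B \<in> {B \<in> sets M. B \<subseteq> space M}"
    then have "\<sigma> B \<le> C" using C[of B] by auto
    then show "ennreal (\<sigma> B) \<le> ennreal C" by (rule ennreal_leI)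
  qed
  then show "emeasure (positive_part M \<sigma>) (space (positive_part M \<sigma>)) \<noteq> \<infinity>"
    by (auto simp: top_unique)
qed

lemma measure_positive_part_upper:
  assumes "A \<in> sets M" "B \<in> sets M" "B \<subseteq> A"
  shows "\<sigma> B \<le> measure (positive_part M \<sigma>) A"
proof -
  interpret finite_measure "positive_part M \<sigma>" by (rule finite_measure_positive_part)
  have "ennreal (\<sigma> B) \<le> emeasure (positive_part M \<sigma>) A"
    unfolding emeasure_positive_part'[OF assms(1)] using assms by (auto intro: SUP_upper)
  then show ?thesis
    by (simp add: emeasure_eq_measure ennreal_le_iff)
qed

lemma measure_positive_part_least:
  assumes "A \<in> sets M" and le: "\<And>B. B \<in> sets M \<Longrightarrow> B \<subseteq> A \<Longrightarrow> \<sigma> B \<le> C"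
  shows "measure (positive_part M \<sigma>) A \<le> C"
proof -
  interpret finite_measure "positive_part M \<sigma>" by (rule finite_measure_positive_part)
  \<comment> \<open>The admissible choice \<open>B = {}\<close> forces this sign; without it
    \<open>ennreal C\<close> would truncate.\<close>
  have "0 \<le> C"
    using le[of "{}"] countably_additive_on_empty[OF \<sigma>] by simp
  moreover have "emeasure (positive_part M \<sigma>) A \<le> ennreal C"
    unfolding emeasure_positive_part'[OF assms(1)] using le by (auto intro!: SUP_least ennreal_leI)
  ultimately show ?thesis
    by (simp add: emeasure_eq_measure ennreal_le_iff)
qed

lemma emeasure_positive_part_eq_0:
  assumes "A \<in> sets M" "\<And>B. B \<in> sets M \<Longrightarrow> B \<subseteq> A \<Longrightarrow> \<sigma> B = 0"
  shows "emeasure (positive_part M \<sigma>) A = 0"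
proof -
  have "emeasure (positive_part M \<sigma>) A \<le> 0"
    unfolding emeasure_positive_part'[OF assms(1)] by (rule SUP_least) (simp add: assms(2))
  then show ?thesis by simp
qed

end

lemma countably_additive_on_uminus:
  "countably_additive_on M \<sigma> \<Longrightarrow> countably_additive_on M (\<lambda>A. - \<sigma> A)"
  by (simp add: countably_additive_on_def sums_minus)

text \<open>Since \<sigma> B = \<sigma> A - \<sigma> (A - B), and B \<mapsto> A - B permutes the
  measurable subsets of A, the supremum of \<sigma> B equals \<sigma> A plus the supremum of
  -\<sigma>. Both inequalities come from this identity, with no Hahn decomposition.\<close>

lemma Jordan_decomposition:
  fixes \<sigma> :: "'a set \<Rightarrow> real"
  assumes \<sigma>: "countably_additive_on M \<sigma>" and A: "A \<in> sets M"
  shows "\<sigma> A = measure (positive_part M \<sigma>) A - measure (positive_part M (\<lambda>A. - \<sigma> A)) A"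
proof -
  note \<sigma>' = countably_additive_on_uminus[OF \<sigma>]
  have diff: "\<sigma> A = \<sigma> B + \<sigma> (A - B)" if "B \<in> sets M" "B \<subseteq> A" for B
    using countably_additive_on_Diff[OF \<sigma> A] that by blast
  have "measure (positive_part M \<sigma>) A \<le> \<sigma> A + measure (positive_part M (\<lambda>A. - \<sigma> A)) A"
  proof (rule measure_positive_part_least[OF \<sigma> A])
    fix B assume B: "B \<in> sets M" "B \<subseteq> A"
    then show "\<sigma> B \<le> \<sigma> A + measure (positive_part M (\<lambda>A. - \<sigma> A)) A"
      using measure_positive_part_upper[OF \<sigma>' A, of "A - B"] diff[OF B] A by auto
  qed
  moreover have "measure (positive_part M (\<lambda>A. - \<sigma> A)) A \<le> measure (positive_part M \<sigma>) A - \<sigma> A"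
  proof (rule measure_positive_part_least[OF \<sigma>' A])
    fix B assume B: "B \<in> sets M" "B \<subseteq> A"
    then show "- \<sigma> B \<le> measure (positive_part M \<sigma>) A - \<sigma> A"
      using measure_positive_part_upper[OF \<sigma> A, of "A - B"] diff[OF B] A by auto
  qed
  ultimately show ?thesis by linarith
qed

section \<open>Complex measures: real components and null sets off the support\<close>

lemma complex_measure_iff_Re_Im:
  "complex_measure M \<mu> \<longleftrightarrow>
     countably_additive_on M (\<lambda>A. Re (\<mu> A)) \<and> countably_additive_on M (\<lambda>A. Im (\<mu> A))"
  unfolding complex_measure_def countably_additive_on_def sums_complex_iff by (simp add: all_conj_distrib imp_conjR)

text \<open>Each point off the support has an open neighbourhood of zero total variation, but there
  may be uncountably many of these. Lindelof's theorem leaves countably many, and countable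
  additivity on their disjointed pieces finishes.\<close>

lemma complex_support_null:
  assumes \<mu>: "complex_measure circle_borel \<mu>" and E: "complex_support \<mu> \<subseteq> E"
    and B: "B \<in> sets circle_borel" "B \<subseteq> unit_circle - E"
  shows "\<mu> B = 0"
proof -
  have ca: "countably_additive_on circle_borel \<mu>"
    using \<mu> by (simp add: complex_measure_def countably_additive_on_def)
  define \<U> where "\<U> = {U :: complex set. open U \<and> total_variation circle_borel \<mu> (U \<inter> unit_circle) = 0}"
  have null: "\<mu> C = 0" if U: "U \<in> \<U>" and C: "C \<in> sets circle_borel" "C \<subseteq> U" for U C
  proof -
    \<comment> \<open>A partition of the null neighbourhood that contains C as a member, so its term
      is bounded by the total variation.\<close>
    let ?P = "binaryset C (U \<inter> unit_circle - C)"
    have sub: "C \<subseteq> unit_circle"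
      using sets.sets_into_space[OF C(1)] by simp
    have "open U" using U unfolding \<U>_def by blast
    then have Uc: "U \<inter> unit_circle \<in> sets circle_borel"
      by (subst sets_restrict_space) (metis Int_commute borel_open image_eqI)
    have "range ?P \<subseteq> sets circle_borel"
      unfolding range_binaryset_eq using C(1) Uc by (simp add: sets.Diff)
    moreover have "disjoint_family ?P"
      by (auto simp: disjoint_family_on_def binaryset_def)
    moreover have "(\<Union>n. ?P n) = U \<inter> unit_circle"
      using C(2) sub unfolding UN_binaryset_eq by blast
    ultimately have P: "?P \<in> {P. range P \<subseteq> sets circle_borel \<and> disjoint_family P \<and> (\<Union>n. P n) = U \<inter> unit_circle}"
      by simp
    then have "(\<Sum>n. ennreal (norm (\<mu> (?P n)))) \<le> total_variation circle_borel \<mu> (U \<inter> unit_circle)"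
      unfolding total_variation_def by (rule SUP_upper)
    then have "(\<Sum>n. ennreal (norm (\<mu> (?P n)))) = 0"
      using U by (simp add: \<U>_def)
    then have "ennreal (norm (\<mu> (?P 0))) = 0"
      using suminf_eq_zero_iff[of "\<lambda>n. ennreal (norm (\<mu> (?P n)))"] by auto
    then show ?thesis by (simp add: binaryset_def)
  qed
  obtain \<V> where \<V>: "\<V> \<subseteq> \<U>" "countable \<V>" "\<Union>\<V> = \<Union>\<U>"
    using Lindelof[of \<U>] unfolding \<U>_def by blast
  have "B \<subseteq> \<Union>\<U>"
  proof
    fix z assume "z \<in> B"
    then have "z \<in> unit_circle" "z \<notin> complex_support \<mu>" using B(2) E by auto
    then obtain U where "open U" "z \<in> U" "total_variation circle_borel \<mu> (U \<inter> unit_circle) = 0"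
      unfolding complex_support_def by blast
    then show "z \<in> \<Union>\<U>" unfolding \<U>_def by blast
  qed
  \<comment> \<open>Inserting the empty set makes the countable family nonempty, as its enumeration
    by \<open>from_nat_into\<close> requires.\<close>
  define V where "V = from_nat_into (insert {} \<V>)"
  have V: "V n \<in> \<U>" "range V = insert {} \<V>" for n
  proof -
    show r: "range V = insert {} \<V>"
      unfolding V_def by (rule range_from_nat_into) (use \<V> in auto)
    have "total_variation circle_borel \<mu> {} \<le> 0"
      unfolding total_variation_def
      by (rule SUP_least) (auto simp: countably_additive_on_empty[OF ca])
    then have "total_variation circle_borel \<mu> {} = 0" by simp
    then have "{} \<in> \<U>" by (simp add: \<U>_def)
    moreover have "V n \<in> insert {} \<V>" using r by blast
    ultimately show "V n \<in> \<U>" using \<V>(1) by auto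
  qed
  have dj: "disjoint_family (\<lambda>n. B \<inter> disjointed V n)"
    using disjoint_family_disjointed[of V] by (auto simp: disjoint_family_on_def)
  have "B \<inter> V n \<in> sets circle_borel" for n
  proof -
    have "open (V n)" using V(1)[of n] unfolding \<U>_def by blast
    then have "V n \<inter> unit_circle \<in> sets circle_borel"
      by (subst sets_restrict_space) (metis Int_commute borel_open image_eqI)
    then have "B \<inter> (V n \<inter> unit_circle) \<in> sets circle_borel"
      using B(1) by (rule sets.Int[rotated])
    moreover have "B \<inter> (V n \<inter> unit_circle) = B \<inter> V n" using B(2) by blast
    ultimately show ?thesis by simp
  qed
  note BV = this
  have meas: "B \<inter> disjointed V n \<in> sets circle_borel" for n
  proof -
    have "B \<inter> disjointed V n = B \<inter> V n - (\<Union>i\<in>{0..<n}. B \<inter> V i)"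
      by (auto simp: disjointed_def)
    also have "\<dots> \<in> sets circle_borel"
      by (intro sets.Diff sets.finite_UN BV finite_atLeastLessThan)
    finally show ?thesis .
  qed
  have "(\<lambda>n. \<mu> (B \<inter> disjointed V n)) sums \<mu> (\<Union>n. B \<inter> disjointed V n)"
    using meas dj by (intro countably_additive_onD[OF ca]) auto
  moreover have "(\<Union>n. B \<inter> disjointed V n) = B"
  proof -
    have "(\<Union>n. disjointed V n) = \<Union>\<U>"
      using V(2) \<V>(3) UN_disjointed_eq[of V] by auto
    then have "(\<Union>n. B \<inter> disjointed V n) = B \<inter> \<Union>\<U>"
      by (simp only: Int_UN_distrib[symmetric])
    then show ?thesis using \<open>B \<subseteq> \<Union>\<U>\<close> by (simp add: Int_absorb2)
  qed
  moreover have "\<mu> (B \<inter> disjointed V n) = 0" for n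
    by (rule null[OF V(1) meas le_infI2[OF disjointed_subset]])
  ultimately have "(\<lambda>n. 0) sums \<mu> B" by simp
  then show ?thesis using sums_unique2 sums_zero by blast
qed

section \<open>Fourier uniqueness on the circle\<close>

lemma measurable_circle_powi [measurable]: "(\<lambda>z::complex. z powi n) \<in> borel_measurable circle_borel"
proof -
  have "continuous_on unit_circle (\<lambda>z::complex. z powi n)"
    by (intro continuous_intros) auto
  then show ?thesis by (rule borel_measurable_continuous_on_restrict)
qed

lemma circle_powi_add: "z \<in> unit_circle \<Longrightarrow> z powi (m + n) = z powi m * (z::complex) powi n"
  by (rule power_int_add) auto

lemma norm_circle_powi: "z \<in> unit_circle \<Longrightarrow> norm ((z::complex) powi n) = 1"
  by (simp add: norm_power_int)

lemma circle_inverse: "z \<in> unit_circle \<Longrightarrow> inverse z = cnj (z::complex)"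
  using cmod_power2[of z] by (simp add: complex_eq_iff)

lemma circle_integrable:
  fixes f :: "complex \<Rightarrow> 'b::{banach, second_countable_topology}"
  assumes p: "finite_measure p" "sets p = sets circle_borel"
    and f: "f \<in> borel_measurable circle_borel" "\<And>z. z \<in> unit_circle \<Longrightarrow> norm (f z) \<le> B"
  shows "integrable p f"
proof -
  interpret finite_measure p by fact
  have "space p = unit_circle" using sets_eq_imp_space_eq[OF p(2)] by simp
  moreover have "f \<in> borel_measurable p" using f(1) measurable_cong_sets[OF p(2) refl] by blast
  ultimately show ?thesis
    using f(2) by (intro integrable_const_bound[of _ B]) auto
qed

text \<open>Equality of the integrals passes from powers to continuous functions by
  Stone-Weierstrass, then to closed sets by monotone approximation of their indicators, and closed
  sets form an intersection-stable generator.\<close>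

lemma finite_circle_measure_eqI:
  assumes p: "finite_measure p" "sets p = sets circle_borel"
    and q: "finite_measure q" "sets q = sets circle_borel"
    and eq: "\<And>n::int. (LINT z|p. z powi n) = (LINT z|q. z powi n)"
  shows "p = q"
proof -
  interpret p: finite_measure p by fact
  interpret q: finite_measure q by fact
  have sp: "space p = unit_circle" and sq: "space q = unit_circle"
    using sets_eq_imp_space_eq[OF p(2)] sets_eq_imp_space_eq[OF q(2)] by auto
  define bm where "bm g \<longleftrightarrow> g \<in> borel_measurable circle_borel \<and> (\<exists>B. \<forall>z\<in>unit_circle. norm (g z) \<le> B)"
    for g :: "complex \<Rightarrow> complex"
  have bm_int: "integrable p g" "integrable q g" if bm: "bm g" for g
  proof -
    obtain B where B: "\<forall>z\<in>unit_circle. norm (g z) \<le> B" and m: "g \<in> borel_measurable circle_borel"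
      using bm unfolding bm_def by blast
    show "integrable p g" "integrable q g"
      by (rule circle_integrable[OF p m bspec[OF B]], assumption)
         (rule circle_integrable[OF q m bspec[OF B]])
  qed
  have bm_mult: "bm (\<lambda>z. f z * g z)" if f: "bm f" and g: "bm g" for f g
  proof -
    obtain B C where B: "\<And>z. z \<in> unit_circle \<Longrightarrow> norm (f z) \<le> B"
      and C: "\<And>z. z \<in> unit_circle \<Longrightarrow> norm (g z) \<le> C"
      using f g unfolding bm_def by metis
    have "norm (f z * g z) \<le> B * C" if "z \<in> unit_circle" for z
      unfolding norm_mult using B[OF that] C[OF that] by (intro mult_mono) (auto intro: order_trans[OF norm_ge_zero])
    moreover have "f \<in> borel_measurable circle_borel" "g \<in> borel_measurable circle_borel"
      using f g by (simp_all add: bm_def)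
    ultimately show ?thesis unfolding bm_def by (intro conjI exI ballI borel_measurable_times borel_measurable_add)
  qed
  have bm_add: "bm (\<lambda>z. f z + g z)" if f: "bm f" and g: "bm g" for f g
  proof -
    obtain B C where B: "\<And>z. z \<in> unit_circle \<Longrightarrow> norm (f z) \<le> B"
      and C: "\<And>z. z \<in> unit_circle \<Longrightarrow> norm (g z) \<le> C"
      using f g unfolding bm_def by metis
    have "norm (f z + g z) \<le> B + C" if "z \<in> unit_circle" for z
      using B[OF that] C[OF that] norm_triangle_ineq[of "f z" "g z"] by linarith
    moreover have "f \<in> borel_measurable circle_borel" "g \<in> borel_measurable circle_borel"
      using f g by (simp_all add: bm_def)
    ultimately show ?thesis unfolding bm_def by (intro conjI exI ballI borel_measurable_times borel_measurable_add)
  qed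
  have bm_powi: "bm (\<lambda>z. z powi n)" for n
    unfolding bm_def by (intro conjI exI[of _ 1] ballI) (simp_all add: norm_circle_powi del: mem_sphere_0)
  have bm_cont: "bm (\<lambda>z. of_real (f z))" if "continuous_on unit_circle f" for f
  proof -
    have "continuous_on unit_circle (\<lambda>z. complex_of_real (f z))"
      using that by (intro continuous_intros)
    moreover have "bounded ((\<lambda>z. complex_of_real (f z)) ` unit_circle)"
      using calculation by (intro compact_imp_bounded compact_continuous_image) auto
    ultimately show ?thesis
      unfolding bm_def bounded_iff by (metis borel_measurable_continuous_on_restrict imageI)
  qed
  \<comment> \<open>Densities g for which g dp and g dq have the same Fourier coefficients. This
    class is stable under linear combinations and under multiplication by powers of z.\<close>
  define G where "G g \<longleftrightarrow> bm g \<and> (\<forall>n. (LINT z|p. g z * z powi n) = (LINT z|q. g z * z powi n))"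
    for g :: "complex \<Rightarrow> complex"
  \<comment> \<open>Real continuous multipliers of the class \<open>G\<close>. Multipliers form an
    algebra automatically, so trigonometric polynomials never have to be expanded; only
    \<open>Re\<close> and \<open>Im\<close> need to be checked, as combinations of z and its
    inverse.\<close>
  define P where "P f \<longleftrightarrow> continuous_on unit_circle f \<and> (\<forall>g. G g \<longrightarrow> G (\<lambda>z. of_real (f z) * g z))"
    for f :: "complex \<Rightarrow> real"
  have intc: "(LINT z|p. f z) = (LINT z|q. f z) \<longleftrightarrow> (LINT z|p. g z) = (LINT z|q. g z)"
    if "\<And>z. z \<in> unit_circle \<Longrightarrow> f z = g z" for f g :: "complex \<Rightarrow> complex"
  proof -
    have "(LINT z|p. f z) = (LINT z|p. g z)" "(LINT z|q. f z) = (LINT z|q. g z)"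
      using that by (auto intro!: Bochner_Integration.integral_cong simp: sp sq)
    then show ?thesis by simp
  qed
  have G_add: "G (\<lambda>z. f z + g z)" if "G f" "G g" for f g
    using that bm_int bm_mult bm_add bm_powi unfolding G_def by (simp add: ring_distribs)
  have G_cmult: "G (\<lambda>z. c * f z)" if "G f" for f c
  proof -
    have "bm (\<lambda>z. c)" unfolding bm_def by (intro conjI exI[of _ "norm c"]) simp_all
    then show ?thesis using that bm_mult[of "\<lambda>z. c" f] unfolding G_def by (simp add: mult.assoc)
  qed
  have G_shift: "G (\<lambda>z. z powi m * f z)" if "G f" for f m
  proof -
    have "(LINT z|p. z powi m * f z * z powi n) = (LINT z|q. z powi m * f z * z powi n)" for n
    proof -
      have "(LINT z|p. f z * z powi (m + n)) = (LINT z|q. f z * z powi (m + n))"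
        using that by (simp add: G_def)
      then show ?thesis
        by (subst intc[where g = "\<lambda>z. f z * z powi (m + n)"]) (simp_all add: circle_powi_add mult_ac)
    qed
    then show ?thesis using that bm_mult[OF bm_powi, of f m] unfolding G_def by simp
  qed
  have G_cong: "G f" if "G g" "bm f" "\<And>z. z \<in> unit_circle \<Longrightarrow> f z = g z" for f g
  proof -
    have "(LINT z|p. f z * z powi n) = (LINT z|q. f z * z powi n)" for n
      by (subst intc[where g = "\<lambda>z. g z * z powi n"]) (use that in \<open>auto simp: G_def\<close>)
    then show ?thesis using that by (simp add: G_def)
  qed
  have G_Re: "G (\<lambda>z. of_real (Re z) * f z)" and G_Im: "G (\<lambda>z. of_real (Im z) * f z)" if "G f" for f
  proof -
    have R: "complex_of_real (Re z) = (1/2) * (z powi 1 + z powi (-1))"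
      and I: "complex_of_real (Im z) = (- \<i> / 2) * (z powi 1 + (-1) * z powi (-1))" if "z \<in> unit_circle" for z
    proof -
      have "inverse z = cnj z" using that by (rule circle_inverse)
      then show "complex_of_real (Re z) = (1/2) * (z powi 1 + z powi (-1))"
        "complex_of_real (Im z) = (- \<i> / 2) * (z powi 1 + (-1) * z powi (-1))"
        by (simp_all add: power_int_minus complex_eq_iff)
    qed
    have bmf: "bm f" using that by (simp add: G_def)
    have "G (\<lambda>z. (1/2) * (z powi 1 * f z + z powi (-1) * f z))"
      by (intro G_cmult G_add G_shift that)
    then show "G (\<lambda>z. of_real (Re z) * f z)"
      by (rule G_cong) (auto simp del: of_real_Re intro!: bm_mult bm_cont bmf continuous_intros simp: R ring_distribs)
    have "G (\<lambda>z. (- \<i> / 2) * (z powi 1 * f z + (-1) * (z powi (-1) * f z)))"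
      by (intro G_cmult G_add G_shift that)
    then show "G (\<lambda>z. of_real (Im z) * f z)"
      by (rule G_cong) (auto intro!: bm_mult bm_cont bmf continuous_intros simp: I field_simps)
  qed
  have G1: "G (\<lambda>z. 1)" unfolding G_def using eq bm_powi[of 0] by simp
  have cont_eq: "(LINT z|p. f z) = (LINT z|q. f z)" if f: "continuous_on unit_circle f" for f :: "complex \<Rightarrow> real"
  proof -
    have approx: "\<exists>g. P g \<and> (\<forall>z\<in>unit_circle. \<bar>f z - g z\<bar> < e)" if "e > 0" for e
    proof (rule Stone_Weierstrass_HOL[where P = P, OF compact_sphere])
      show "P (\<lambda>x. c)" for c unfolding P_def using G_cmult by simp
      show "\<And>f. P f \<Longrightarrow> continuous_on unit_circle f" by (simp add: P_def)
      show "\<And>f g. P f \<and> P g \<Longrightarrow> P (\<lambda>x. f x + g x)"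
        unfolding P_def using G_add by (auto intro!: continuous_intros simp: ring_distribs)
      show "\<And>f g. P f \<and> P g \<Longrightarrow> P (\<lambda>x. f x * g x)"
        unfolding P_def by (auto intro!: continuous_intros simp: mult.assoc)
      have "P Re" "P Im" unfolding P_def using G_Re G_Im by (auto intro!: continuous_intros)
      then show "\<And>x y. x \<in> unit_circle \<and> y \<in> unit_circle \<and> x \<noteq> y \<Longrightarrow> \<exists>f. P f \<and> f x \<noteq> f y"
        by (meson complex_eqI)
    qed (use f that in auto)
    have Peq: "(LINT z|p. g z) = (LINT z|q. g z)" if "P g" for g
    proof -
      have "G (\<lambda>z. of_real (g z) * 1)" using that G1 unfolding P_def by blast
      then have "(LINT z|p. of_real (g z) * z powi 0) = (LINT z|q. complex_of_real (g z) * z powi 0)"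
        unfolding G_def by (auto dest: spec[of _ 0])
      then show ?thesis by simp
    qed
    have int: "integrable p f" "integrable q f" if "continuous_on unit_circle f" for f :: "complex \<Rightarrow> real"
      using bm_int[OF bm_cont[OF that]] by (simp_all add: complex_of_real_integrable_eq)
    have bound: "\<bar>(LINT z|p. f z) - (LINT z|q. f z)\<bar> \<le> e * (measure p (space p) + measure q (space q))"
      if e: "e > 0" for e
    proof -
      obtain g where g: "P g" "\<And>z. z \<in> unit_circle \<Longrightarrow> \<bar>f z - g z\<bar> < e" using approx[OF e] by blast
      have cg: "continuous_on unit_circle g" using g(1) by (simp add: P_def)
      have *: "\<bar>LINT z|r. k z\<bar> \<le> e * measure r (space r)"
        if r: "finite_measure r" "space r = unit_circle" and k: "integrable r k"
          "\<And>z. z \<in> unit_circle \<Longrightarrow> \<bar>k z\<bar> < e" for r k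
      proof -
        interpret r: finite_measure r by fact
        have "\<bar>LINT z|r. k z\<bar> \<le> (LINT z|r. \<bar>k z\<bar>)"
          using integral_norm_bound[of r k] by simp
        also have "\<dots> \<le> (LINT z|r. e)"
          using k(1) by (intro integral_mono) (auto simp: r(2) intro!: less_imp_le k(2))
        finally show ?thesis by (simp add: mult.commute)
      qed
      have "\<bar>(LINT z|p. f z - g z)\<bar> \<le> e * measure p (space p)"
        using *[OF p.finite_measure_axioms sp, of "\<lambda>z. f z - g z"] int[OF f] int[OF cg] g(2) by simp
      moreover have "\<bar>(LINT z|q. f z - g z)\<bar> \<le> e * measure q (space q)"
        using *[OF q.finite_measure_axioms sq, of "\<lambda>z. f z - g z"] int[OF f] int[OF cg] g(2) by simp
      ultimately show ?thesis
        using Peq[OF g(1)] int[OF f] int[OF cg] by (simp add: ring_distribs)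
    qed
    have "(\<lambda>n. inverse (real (Suc n)) * (measure p (space p) + measure q (space q))) \<longlonglongrightarrow> 0"
      by (intro tendsto_mult_left_zero LIMSEQ_inverse_real_of_nat)
    then have "\<bar>(LINT z|p. f z) - (LINT z|q. f z)\<bar> \<le> 0"
      by (rule LIMSEQ_le_const) (use bound in auto)
    then show ?thesis by simp
  qed
  have int: "integrable p f" "integrable q f" if "continuous_on unit_circle f" for f :: "complex \<Rightarrow> real"
    using bm_int[OF bm_cont[OF that]] by (simp_all add: complex_of_real_integrable_eq)
  have closed_eq: "measure p C = measure q C" if C: "closed C" "C \<noteq> {}" "C \<subseteq> unit_circle" for C
  proof -
    \<comment> \<open>Continuous functions equal to 1 on C that vanish eventually at each point
      outside, where the distance to the closed set C is positive.\<close>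
    define f where "f n z = max 0 (1 - real n * infdist z C)" for n z
    have cont: "continuous_on unit_circle (f n)" for n
      unfolding f_def by (intro continuous_intros)
    have lim: "(\<lambda>n. f n z) \<longlonglongrightarrow> indicator C z" for z
    proof (cases "z \<in> C")
      case True
      then show ?thesis by (simp add: f_def)
    next
      case False
      then have pos: "infdist z C > 0"
        using C by (simp add: in_closed_iff_infdist_zero[of C z] order_less_le infdist_nonneg)
      obtain N :: nat where N: "1 / infdist z C < real N" using reals_Archimedean2 by blast
      have "f n z = 0" if "n \<ge> N" for n
      proof -
        have "1 < real N * infdist z C" using N pos by (simp add: field_simps)
        also have "\<dots> \<le> real n * infdist z C" using that pos by (intro mult_right_mono) auto
        finally show ?thesis by (simp add: f_def)
      qed
      then have "eventually (\<lambda>n. f n z = 0) sequentially"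
        by (auto simp: eventually_sequentially)
      then show ?thesis using False by (simp add: tendsto_eventually)
    qed
    have bound: "norm (f n z) \<le> 1" for n z
      by (simp add: f_def infdist_nonneg)
    have *: "(\<lambda>n. LINT z|r. f n z) \<longlonglongrightarrow> measure r C"
      if r: "finite_measure r" "sets r = sets circle_borel" and i: "\<And>n. integrable r (f n)" for r
    proof -
      interpret r: finite_measure r by fact
      have "C \<in> sets r" using C unfolding r(2) by (auto simp: sets_restrict_space)
      have "(\<lambda>n. LINT z|r. f n z) \<longlonglongrightarrow> (LINT z|r. indicator C z)"
        using lim bound borel_measurable_integrable[OF i] \<open>C \<in> sets r\<close>
        by (intro integral_dominated_convergence[where w = "\<lambda>_. 1"]) auto
      then show ?thesis using \<open>C \<in> sets r\<close> sets.sets_into_space[of C r] by (simp add: Int_absorb2)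
    qed
    have "(\<lambda>n. LINT z|p. f n z) \<longlonglongrightarrow> measure p C" "(\<lambda>n. LINT z|p. f n z) \<longlonglongrightarrow> measure q C"
      using *[OF p int(1)[OF cont]] *[OF q int(2)[OF cont]] cont_eq[OF cont] by simp_all
    then show ?thesis by (rule LIMSEQ_unique)
  qed
  show ?thesis
  proof (rule measure_eqI_generator_eq_countable[where E = "{C. closed C \<and> C \<subseteq> unit_circle}" and \<Omega> = unit_circle and A = "{unit_circle}"])
    have "sets circle_borel = sigma_sets unit_circle {C. closed C \<and> C \<subseteq> unit_circle}"
    proof -
      have "sets circle_borel = sigma_sets unit_circle ((\<inter>) unit_circle ` Collect closed)"
        by (simp add: sets_restrict_space borel_eq_closed sigma_sets_Int sigma_sets.Basic)
      moreover have "(\<inter>) unit_circle ` Collect closed = {C. closed C \<and> C \<subseteq> unit_circle}"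
        by (auto intro!: image_eqI)
      ultimately show ?thesis by simp
    qed
    then show "sets p = sigma_sets unit_circle {C. closed C \<and> C \<subseteq> unit_circle}"
      "sets q = sigma_sets unit_circle {C. closed C \<and> C \<subseteq> unit_circle}"
      using p q by simp_all
    show "Int_stable {C. closed C \<and> C \<subseteq> unit_circle}"
      by (auto simp: Int_stable_def)
    show "emeasure p X = emeasure q X" if "X \<in> {C. closed C \<and> C \<subseteq> unit_circle}" for X
      using closed_eq[of X] that by (cases "X = {}") (auto simp: p.emeasure_eq_measure q.emeasure_eq_measure)
  qed (auto simp: p.emeasure_eq_measure)
qed

section \<open>Parseval on circles\<close>

lemma integral_circle_powers:
  fixes m n :: nat
  shows "(LINT t:{0..2*pi}|lborel. cis (real m * t) * cnj (cis (real n * t))) = (if m = n then 2 * pi else 0)"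
proof (cases "m = n")
  case True
  then show ?thesis by (simp add: cis_mult cis_cnj set_lebesgue_integral_def scaleR_conv_of_real)
next
  case False
  define k where "k = real m - real n"
  have k: "k \<noteq> 0" using False by (simp add: k_def)
  have "((\<lambda>t. cis (k * t)) has_integral (cis (k * (2*pi)) / (\<i> * k) - cis (k * 0) / (\<i> * k))) {0..2*pi}"
  proof (intro fundamental_theorem_of_calculus)
    fix t :: real
    have "((\<lambda>z. exp (\<i> * of_real k * z) / (\<i> * of_real k)) has_field_derivative exp (\<i> * of_real k * of_real t)) (at (of_real t))"
      using k by (auto intro!: derivative_eq_intros)
    from has_vector_derivative_real_field[OF this]
    show "((\<lambda>t. cis (k * t) / (\<i> * k)) has_vector_derivative cis (k * t)) (at t within {0..2*pi})"
      by (simp add: cis_conv_exp mult.assoc)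
  qed simp
  moreover have "cis (k * (2*pi)) = 1"
  proof -
    have "k * (2*pi) = 2 * pi * of_int (int m - int n)" by (simp add: k_def)
    then show ?thesis by (simp only: cis_multiple_2pi Ints_of_int)
  qed
  ultimately have "((\<lambda>t. cis (k * t)) has_integral 0) {0..2*pi}" by simp
  moreover have "set_integrable lborel {0..2*pi} (\<lambda>t. cis (k * t))"
    by (intro borel_integrable_atLeastAtMost') (auto intro!: continuous_intros)
  ultimately have "(LINT t:{0..2*pi}|lborel. cis (k * t)) = 0"
    using set_borel_integral_eq_integral(2) integral_unique by metis
  then show ?thesis using False
    by (simp add: cis_mult cis_cnj k_def algebra_simps)
qed

text \<open>Partial sums reduce to orthogonality. Absolute summability bounds all of them by the
  constant B, so dominated convergence passes to the limit.\<close>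

lemma Parseval_circle:
  fixes b :: "nat \<Rightarrow> complex"
  assumes b: "summable (\<lambda>n. norm (b n))"
  shows "(LINT t:{0..2*pi}|lborel. (norm (\<Sum>n. b n * cis (real n * t)))\<^sup>2) = 2 * pi * (\<Sum>n. (norm (b n))\<^sup>2)"
    and "summable (\<lambda>n. (norm (b n))\<^sup>2)"
    and "set_integrable lborel {0..2*pi} (\<lambda>t. (norm (\<Sum>n. b n * cis (real n * t)))\<^sup>2)"
proof -
  define S where "S N t = (\<Sum>n<N. b n * cis (real n * t))" for N t
  define f where "f t = (\<Sum>n. b n * cis (real n * t))" for t
  define B where "B = (\<Sum>n. norm (b n))"
  have lim: "(\<lambda>N. S N t) \<longlonglongrightarrow> f t" for t
    unfolding S_def f_def
    by (rule summable_LIMSEQ, rule summable_norm_cancel) (use b in \<open>simp add: norm_mult\<close>)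
  have SB: "norm (S N t) \<le> B" for N t
    unfolding S_def B_def
    by (rule order_trans[OF norm_sum]) (auto simp: norm_mult intro!: sum_le_suminf b)
  have ic: "set_integrable lborel {0..2*pi} (\<lambda>t. b m * cis (real m * t) * cnj (b n * cis (real n * t)))" for m n
    by (intro borel_integrable_atLeastAtMost') (auto intro!: continuous_intros)
  have SN: "(LINT t:{0..2*pi}|lborel. (norm (S N t))\<^sup>2) = 2 * pi * (\<Sum>n<N. (norm (b n))\<^sup>2)" for N
  proof -
    have "complex_of_real (LINT t:{0..2*pi}|lborel. (norm (S N t))\<^sup>2)
        = (LINT t:{0..2*pi}|lborel. complex_of_real ((norm (S N t))\<^sup>2))"
      unfolding set_lebesgue_integral_def by (simp flip: integral_complex_of_real add: scaleR_conv_of_real)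
    also have "\<dots> = (LINT t:{0..2*pi}|lborel. (\<Sum>m<N. \<Sum>n<N. b m * cis (real m * t) * cnj (b n * cis (real n * t))))"
      unfolding S_def by (simp only: complex_norm_square cnj_sum sum_product)
    also have "\<dots> = (\<Sum>m<N. \<Sum>n<N. (LINT t:{0..2*pi}|lborel. b m * cis (real m * t) * cnj (b n * cis (real n * t))))"
      unfolding set_lebesgue_integral_def scaleR_sum_right
      by (simp only: Bochner_Integration.integral_sum Bochner_Integration.integrable_sum ic[unfolded set_integrable_def])
    also have "\<dots> = (\<Sum>m<N. \<Sum>n<N. b m * cnj (b n) * (if m = n then 2 * pi else 0))"
    proof (intro sum.cong refl)
      fix m n
      have "(LINT t:{0..2*pi}|lborel. b m * cis (real m * t) * cnj (b n * cis (real n * t)))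
          = (LINT t:{0..2*pi}|lborel. (b m * cnj (b n)) * (cis (real m * t) * cnj (cis (real n * t))))"
        by (simp add: mult_ac)
      also have "\<dots> = b m * cnj (b n) * (LINT t:{0..2*pi}|lborel. cis (real m * t) * cnj (cis (real n * t)))"
        by (rule set_integral_mult_right)
      finally show "(LINT t:{0..2*pi}|lborel. b m * cis (real m * t) * cnj (b n * cis (real n * t)))
          = b m * cnj (b n) * complex_of_real (if m = n then 2 * pi else 0)"
        by (simp only: integral_circle_powers)
    qed
    also have "\<dots> = complex_of_real (2 * pi * (\<Sum>n<N. (norm (b n))\<^sup>2))"
    proof -
      have "(\<Sum>m<N. \<Sum>n<N. b m * cnj (b n) * complex_of_real (if m = n then 2 * pi else 0))
          = (\<Sum>m<N. b m * cnj (b m) * complex_of_real (2 * pi))"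
        by (simp add: if_distrib[of "\<lambda>x. _ * complex_of_real x"] cong: if_cong)
      also have "\<dots> = complex_of_real (2 * pi * (\<Sum>n<N. (norm (b n))\<^sup>2))"
        by (simp only: complex_norm_square[symmetric] of_real_mult[symmetric] of_real_sum[symmetric] sum_distrib_left mult.commute)
      finally show ?thesis .
    qed
    finally show ?thesis by (simp only: of_real_eq_iff)
  qed
  have meas: "S N \<in> borel_measurable borel" for N
    unfolding S_def by (intro borel_measurable_continuous_onI continuous_intros)
  have fmeas: "f \<in> borel_measurable borel"
    using borel_measurable_LIMSEQ_metric[OF meas lim] .
  have bint: "set_integrable lborel {0..2*pi} (\<lambda>t. B\<^sup>2)"
    by (intro borel_integrable_atLeastAtMost') (auto intro!: continuous_intros)
  have sq: "(norm (S N t))\<^sup>2 \<le> B\<^sup>2" for N t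
    using SB by (intro power_mono) auto
  have sqf: "(norm (f t))\<^sup>2 \<le> B\<^sup>2" for t
    using LIMSEQ_le_const2[OF tendsto_power[OF tendsto_norm[OF lim]]] sq by blast
  have conv: "(\<lambda>N. LINT t:{0..2*pi}|lborel. (norm (S N t))\<^sup>2) \<longlonglongrightarrow> (LINT t:{0..2*pi}|lborel. (norm (f t))\<^sup>2)"
    unfolding set_lebesgue_integral_def
  proof (rule integral_dominated_convergence[where w = "\<lambda>t. indicator {0..2*pi} t *\<^sub>R B\<^sup>2"])
    show "integrable lborel (\<lambda>t. indicator {0..2*pi} t *\<^sub>R B\<^sup>2)" using bint by (simp add: set_integrable_def)
    show "AE t in lborel. norm (indicator {0..2*pi} t *\<^sub>R (norm (S N t))\<^sup>2) \<le> indicator {0..2*pi} t *\<^sub>R B\<^sup>2" for N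
      using sq by (auto split: split_indicator)
    show "AE t in lborel. (\<lambda>N. indicator {0..2*pi} t *\<^sub>R (norm (S N t))\<^sup>2) \<longlonglongrightarrow> indicator {0..2*pi} t *\<^sub>R (norm (f t))\<^sup>2"
      by (intro AE_I2 tendsto_intros lim)
  qed (use meas fmeas in \<open>auto intro!: borel_measurable_scaleR borel_measurable_indicator borel_measurable_power borel_measurable_norm\<close>)
  show sumsq: "summable (\<lambda>n. (norm (b n))\<^sup>2)"
  proof (rule summable_comparison_test_ev[OF _ b])
    have "(\<lambda>n. norm (b n)) \<longlonglongrightarrow> 0" using b by (rule summable_LIMSEQ_zero)
    then have "eventually (\<lambda>n. norm (b n) < 1) sequentially" by (rule order_tendstoD) simp
    then show "eventually (\<lambda>n. norm ((norm (b n))\<^sup>2) \<le> norm (b n)) sequentially"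
      by eventually_elim (simp add: power2_eq_square mult_left_le)
  qed
  have "(\<lambda>N. 2 * pi * (\<Sum>n<N. (norm (b n))\<^sup>2)) \<longlonglongrightarrow> 2 * pi * (\<Sum>n. (norm (b n))\<^sup>2)"
    by (intro tendsto_intros summable_LIMSEQ sumsq)
  then have "(LINT t:{0..2*pi}|lborel. (norm (f t))\<^sup>2) = 2 * pi * (\<Sum>n. (norm (b n))\<^sup>2)"
    using conv unfolding SN by (rule LIMSEQ_unique[rotated])
  then show "(LINT t:{0..2*pi}|lborel. (norm (\<Sum>n. b n * cis (real n * t)))\<^sup>2) = 2 * pi * (\<Sum>n. (norm (b n))\<^sup>2)"
    by (simp add: f_def)
  have "set_integrable lborel {0..2*pi} (\<lambda>t. (norm (f t))\<^sup>2)"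
    unfolding set_integrable_def
    by (rule Bochner_Integration.integrable_bound[OF bint[unfolded set_integrable_def]])
       (use fmeas sqf in \<open>auto intro!: borel_measurable_scaleR borel_measurable_indicator borel_measurable_power borel_measurable_norm split: split_indicator\<close>)
  then show "set_integrable lborel {0..2*pi} (\<lambda>t. (norm (\<Sum>n. b n * cis (real n * t)))\<^sup>2)"
    by (simp add: f_def)
qed

text \<open>A pointwise bound between two power series does not compare individual coefficients, but
  it compares the mean squares on the circle of radius \<rho>, which Parseval turns into weighted
  sums of squares.\<close>

lemma coefficient_majorization:
  fixes a b :: "nat \<Rightarrow> complex" and \<rho> :: real
  assumes \<rho>: "0 \<le> \<rho>" and a: "summable (\<lambda>n. norm (a n) * \<rho> ^ n)" and b: "summable (\<lambda>n. norm (b n) * \<rho> ^ n)"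
    and le: "\<And>z. norm z = \<rho> \<Longrightarrow> norm (\<Sum>n. a n * z ^ n) \<le> norm (\<Sum>n. b n * z ^ n)"
  shows "(\<Sum>n. (norm (a n))\<^sup>2 * \<rho> ^ (2 * n)) \<le> (\<Sum>n. (norm (b n))\<^sup>2 * \<rho> ^ (2 * n))"
    and "summable (\<lambda>n. (norm (a n))\<^sup>2 * \<rho> ^ (2 * n))"
proof -
  have P: "summable (\<lambda>n. norm (c n * of_real \<rho> ^ n))" if "summable (\<lambda>n. norm (c n) * \<rho> ^ n)" for c :: "nat \<Rightarrow> complex"
    using that \<rho> by (simp add: norm_mult norm_power)
  have eq: "(\<Sum>n. c n * of_real \<rho> ^ n * cis (real n * t)) = (\<Sum>n. c n * (of_real \<rho> * cis t) ^ n)" for c :: "nat \<Rightarrow> complex" and t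
    by (simp add: power_mult_distrib Complex.DeMoivre mult_ac)
  have nrm: "(norm (c n * of_real \<rho> ^ n))\<^sup>2 = (norm (c n))\<^sup>2 * \<rho> ^ (2 * n)" for c :: "nat \<Rightarrow> complex" and n
    using \<rho> by (simp add: norm_mult norm_power power_mult_distrib power_mult mult.commute[of 2])
  note A = Parseval_circle[OF P[OF a]] and B = Parseval_circle[OF P[OF b]]
  have "2 * pi * (\<Sum>n. (norm (a n))\<^sup>2 * \<rho> ^ (2 * n)) \<le> 2 * pi * (\<Sum>n. (norm (b n))\<^sup>2 * \<rho> ^ (2 * n))"
    unfolding nrm[symmetric] A(1)[symmetric] B(1)[symmetric]
    by (rule set_integral_mono[OF A(3) B(3)]) (use \<rho> in \<open>auto simp: eq norm_mult intro!: power_mono le\<close>)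
  then show "(\<Sum>n. (norm (a n))\<^sup>2 * \<rho> ^ (2 * n)) \<le> (\<Sum>n. (norm (b n))\<^sup>2 * \<rho> ^ (2 * n))"
    by simp
  show "summable (\<lambda>n. (norm (a n))\<^sup>2 * \<rho> ^ (2 * n))"
    using A(2) by (simp only: nrm)
qed

section \<open>Dirichlet-type weights\<close>

lemma ex_dyadic: "n \<ge> 1 \<Longrightarrow> \<exists>k. n \<le> 2 ^ k \<and> 2 ^ k < 2 * n" for n :: nat
proof -
  assume n: "n \<ge> 1"
  define k where "k = (LEAST k. n \<le> 2 ^ k)"
  have ex: "n \<le> 2 ^ n" by (simp add: less_imp_le)
  have 1: "n \<le> 2 ^ k" unfolding k_def by (rule LeastI[of _ n]) (rule ex)
  have 2: "2 ^ k < 2 * n"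
  proof (cases k)
    case 0 then show ?thesis using n by simp
  next
    case (Suc j)
    then have "\<not> n \<le> 2 ^ j" using not_less_Least[of j "\<lambda>k. n \<le> 2 ^ k"] by (simp add: k_def)
    then show ?thesis using Suc by simp
  qed
  show ?thesis using 1 2 by blast
qed

text \<open>The constant is written as 4 \<rho> because the quantities 4^(-k) / \<omega>(2^k) then
  decrease at least by the factor \<rho> < 1 from one dyadic level to the next. For moments, \<rho>
  is half the constant of \<open>condition_C3\<close>.\<close>

locale doubling_weight =
  fixes \<omega> :: "nat \<Rightarrow> real" and \<rho> :: real
  assumes pos: "\<And>n. 0 < \<omega> n"
    and dec: "decseq \<omega>"
    and doubling: "\<And>n. \<omega> n \<le> 4 * \<rho> * \<omega> (2 * n)"
    and rho_less_1: "\<rho> < 1"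
begin

lemma rho_pos: "0 < \<rho>"
proof (rule ccontr)
  assume "\<not> 0 < \<rho>"
  then have "4 * \<rho> * \<omega> (2 * 0) \<le> 0" using pos[of 0] by (simp add: mult_nonpos_nonneg)
  then show False using doubling[of 0] pos[of 0] by linarith
qed

text \<open>The mass placed on the circle of radius \<open>level_radius k\<close> in a discretized
  area integral. It is chosen so that n^2 times this mass is comparable to 1 / \<omega>(n) when n is
  about 2^k.\<close>

definition level_weight :: "nat \<Rightarrow> real" where
  "level_weight k = 1 / (4 ^ k * \<omega> (2 ^ k))"

definition level_radius :: "nat \<Rightarrow> real" where
  "level_radius k = 1 - 1 / 2 ^ k"

lemma level_weight_pos: "0 < level_weight k"
  using pos by (simp add: level_weight_def)

lemma level_radius_bounds: "0 \<le> level_radius k" "level_radius k < 1"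
  by (simp_all add: level_radius_def)

text \<open>The factor that multiplies the squared modulus of the m-th coefficient of f' in the sum,
  over levels up to K, of the mean of |f'|^2 on the level circle. The cutoff K makes this a finite
  sum, which may be exchanged with any convergent series over coefficients.\<close>

definition dirichlet_weight :: "nat \<Rightarrow> nat \<Rightarrow> real" where
  "dirichlet_weight K m = (\<Sum>k\<le>K. level_weight k * level_radius k ^ (2 * m))"

lemma level_weight_decay: "level_weight (k + j) \<le> \<rho> ^ j * level_weight k"
proof (induction j)
  case (Suc j)
  have "level_weight (Suc i) \<le> \<rho> * level_weight i" for i
    using doubling[of "2 ^ i"] pos[of "2 ^ i"] pos[of "2 * 2 ^ i"]
    by (simp add: level_weight_def field_simps)
  then have "level_weight (k + Suc j) \<le> \<rho> * level_weight (k + j)" by simp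
  also have "\<dots> \<le> \<rho> * (\<rho> ^ j * level_weight k)"
    using Suc rho_pos by (intro mult_left_mono) auto
  finally show ?case by (simp add: mult_ac)
qed simp

text \<open>The single level with n \<le> 2^k < 2n, where n = m + 1, already suffices: its mass is
  at least 1 / (4 n^2 \<omega>(n)) and the power of its radius at least 1/16. The cutoff 2N includes
  it because k < 2^k < 2n \<le> 2N.\<close>

lemma dirichlet_weight_ge:
  assumes "m < N"
  shows "1 / (64 * \<omega> (Suc m)) \<le> (real (Suc m))\<^sup>2 * dirichlet_weight (2 * N) m"
proof -
  define n where "n = Suc m"
  obtain k where k: "n \<le> 2 ^ k" "2 ^ k < 2 * n" using ex_dyadic[of n] by (auto simp: n_def)
  have n: "real n > 0" by (simp add: n_def)
  have "k < (2::nat) ^ k" by simp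
  then have "k < 2 * n" using k(2) by (rule less_trans)
  moreover have "2 * n \<le> 2 * N" using assms by (simp add: n_def)
  ultimately have kN: "k \<le> 2 * N" by (rule less_imp_le[OF less_le_trans])
  \<comment> \<open>Bernoulli gives (1 - 2^(-k))^(2^(k-1)) \<ge> 1/2. The fourth power has exponent
    2 * 2^k, which is at least 2m.\<close>
  have r: "1 / 16 \<le> level_radius k ^ (2 * m)"
  proof (cases k)
    \<comment> \<open>Here the radius is 0, but n \<le> 1 forces m = 0 and the power is 0^0 =
      1.\<close>
    case 0
    then show ?thesis using k by (simp add: n_def)
  next
    case (Suc j)
    have "1 + real (2 ^ j) * (- (1 / 2 ^ k)) \<le> (1 + (- (1 / 2 ^ k))) ^ (2 ^ j)"
      by (rule Bernoulli_inequality) simp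
    then have "1 / 2 \<le> level_radius k ^ (2 ^ j)"
      using Suc by (simp add: level_radius_def)
    then have "(1 / 2) ^ 4 \<le> (level_radius k ^ (2 ^ j)) ^ 4"
      by (rule power_mono) simp
    also have "\<dots> = level_radius k ^ (2 * 2 ^ k)"
      by (simp add: Suc mult.commute flip: power_mult)
    also have "\<dots> \<le> level_radius k ^ (2 * m)"
      using level_radius_bounds[of k] k by (intro power_decreasing) (auto simp: n_def)
    finally show ?thesis by (simp add: power_divide)
  qed
  have "1 / (64 * \<omega> n) = (real n)\<^sup>2 * (1 / ((2 * real n)\<^sup>2 * \<omega> n) * (1 / 16))"
    using pos[of n] n by (simp add: power2_eq_square)
  also have "\<dots> \<le> (real n)\<^sup>2 * (level_weight k * level_radius k ^ (2 * m))"
  proof (intro mult_left_mono mult_mono r)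
    have "real (2 ^ k) \<le> real (2 * n)" using k(2) by (simp only: of_nat_le_iff)
    then have "(2::real) ^ k \<le> 2 * real n" by simp
    then have "((2::real) ^ k)\<^sup>2 \<le> (2 * real n)\<^sup>2" by (rule power_mono) simp
    moreover have "((2::real) ^ k)\<^sup>2 = 4 ^ k" by (simp add: power2_eq_square flip: power_mult_distrib)
    ultimately have "4 ^ k * \<omega> (2 ^ k) \<le> (2 * real n)\<^sup>2 * \<omega> n"
      using decseqD[OF dec k(1)] pos[of "2 ^ k"] by (intro mult_mono) auto
    then show "1 / ((2 * real n)\<^sup>2 * \<omega> n) \<le> level_weight k"
      unfolding level_weight_def using pos[of "2 ^ k"] by (intro divide_left_mono mult_pos_pos) (auto simp: pos n_def)
  qed (use level_weight_pos[of k] in auto)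
  also have "\<dots> \<le> (real n)\<^sup>2 * dirichlet_weight (2 * N) m"
    unfolding dirichlet_weight_def
    using kN level_weight_pos level_radius_bounds
    by (intro mult_left_mono member_le_sum[of k]) (auto intro!: mult_nonneg_nonneg less_imp_le[OF level_weight_pos])
  finally show ?thesis by (simp add: n_def)
qed

text \<open>The 54 bounds the levels with 2^k below n, the second summand the geometric tail of the
  remaining levels.\<close>

definition dirichlet_const :: real where
  "dirichlet_const = 54 + 4 * \<rho> / (1 - \<rho>)"

lemma dirichlet_const_nonneg: "0 \<le> dirichlet_const"
  using rho_pos rho_less_1 by (simp add: dirichlet_const_def)

text \<open>The sum is split at the level k0 with n \<le> 2^k0 < 2n. Below it, with x = n / 2^k, the
  mass contributes at most x^2 / \<omega>(n), while the radius power is at most exp(-x) \<le> 27 /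
  x^3; the product is a constant times 1/x, which is summable over k. From k0 on, the radius is
  bounded by 1 and the masses decay like \<rho>^j.\<close>

lemma dirichlet_weight_le: "(real (Suc m))\<^sup>2 * dirichlet_weight K m \<le> dirichlet_const / \<omega> (Suc m)"
proof -
  define n where "n = Suc m"
  have n: "real n > 0" by (simp add: n_def)
  obtain k0 where k0: "n \<le> 2 ^ k0" "2 ^ k0 < 2 * n" using ex_dyadic[of n] by (auto simp: n_def)
  define f where "f k = (real n)\<^sup>2 * (level_weight k * level_radius k ^ (2 * m))" for k
  have f0: "0 \<le> f k" for k
    unfolding f_def using level_weight_pos[of k] level_radius_bounds[of k] by simp
  have low: "f k \<le> 27 * 2 ^ k / (real n * \<omega> n)" if "k < k0" for k
  proof -
    have kn: "2 ^ k < n"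
    proof -
      have "2 ^ Suc k \<le> (2::nat) ^ k0" using that by (intro power_increasing) auto
      then show ?thesis using k0 by simp
    qed
    then have knr: "(2::real) ^ k < real n" by (metis of_nat_less_iff of_nat_numeral of_nat_power)
    define x where "x = real n / 2 ^ k"
    have x: "x > 0" using n by (simp add: x_def)
    \<comment> \<open>Since 1 \<le> 2^k < n, one has n \<ge> 2 and hence n \<le> 2 (n - 1) =
      2m.\<close>
    have "level_radius k ^ (2 * m) \<le> level_radius k ^ n"
    proof -
      have "1 \<le> (2::nat) ^ k" by simp
      then have "n \<le> 2 * m" using kn unfolding n_def by linarith
      then show ?thesis using level_radius_bounds[of k] by (intro power_decreasing) auto
    qed
    also have "\<dots> \<le> exp (- (1 / 2 ^ k)) ^ n"
      using exp_ge_add_one_self[of "- (1 / 2 ^ k)"] level_radius_bounds[of k]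
      by (intro power_mono) (auto simp: level_radius_def)
    also have "\<dots> = exp (- x)"
      by (simp add: x_def flip: exp_of_nat_mult)
    \<comment> \<open>A third power is the first that beats x^2. It comes from exp x = (exp (x/3))^3
      \<ge> (x/3)^3.\<close>
    also have "\<dots> \<le> 27 / x ^ 3"
    proof -
      have "(x / 3) ^ 3 \<le> exp (x / 3) ^ 3"
        using exp_ge_add_one_self[of "x / 3"] x by (intro power_mono) (linarith, simp)
      also have "exp (x / 3) ^ 3 = exp x" by (simp flip: exp_of_nat_mult)
      finally have "x ^ 3 / 27 \<le> exp x" by (simp add: power_divide)
      then show ?thesis using x by (simp add: exp_minus field_simps)
    qed
    finally have r: "level_radius k ^ (2 * m) \<le> 27 / x ^ 3" .
    have w: "level_weight k \<le> 1 / (4 ^ k * \<omega> n)"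
      unfolding level_weight_def using decseqD[OF dec less_imp_le[OF kn]] pos[of n] pos[of "2 ^ k"]
      by (intro divide_left_mono mult_left_mono mult_pos_pos) auto
    have "f k \<le> (real n)\<^sup>2 * (1 / (4 ^ k * \<omega> n) * (27 / x ^ 3))"
      unfolding f_def using r w level_radius_bounds[of k] pos[of n]
      by (intro mult_left_mono mult_mono) auto
    also have "\<dots> = 27 * 2 ^ k / (real n * \<omega> n)"
    proof -
      have "(4::real) ^ k = 2 ^ k * 2 ^ k" by (simp flip: power_mult_distrib)
      then show ?thesis using n pos[of n] by (simp add: x_def field_simps power2_eq_square power3_eq_cube)
    qed
    finally show ?thesis .
  qed
  have high: "f (k0 + j) \<le> 4 * \<rho> / \<omega> n * \<rho> ^ j" for j
  proof -
    have "level_radius (k0 + j) ^ (2 * m) \<le> 1"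
      using level_radius_bounds[of "k0 + j"] by (simp add: power_le_one)
    then have "f (k0 + j) \<le> (real n)\<^sup>2 * (level_weight (k0 + j) * 1)"
      unfolding f_def using level_weight_pos[of "k0 + j"] by (intro mult_left_mono) auto
    also have "\<dots> \<le> (real n)\<^sup>2 * (\<rho> ^ j * level_weight k0)"
      using level_weight_decay[of k0 j] by (simp add: mult_left_mono)
    \<comment> \<open>Here 2^k0 lies between n and 2n, so n^2 \<le> 4^k0, and doubling followed by
      monotonicity gives \<omega>(n) \<le> 4 \<rho> \<omega>(2n) \<le> 4 \<rho>
      \<omega>(2^k0).\<close>
    also have "(real n)\<^sup>2 * level_weight k0 \<le> 4 * \<rho> / \<omega> n"
    proof -
      have "real n \<le> 2 ^ k0" using k0(1) by (metis of_nat_le_iff of_nat_numeral of_nat_power)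
      then have "(real n)\<^sup>2 \<le> (2 ^ k0)\<^sup>2" by (rule power_mono) simp
      also have "((2::real) ^ k0)\<^sup>2 = 4 ^ k0" by (simp add: power2_eq_square flip: power_mult_distrib)
      finally have "(real n)\<^sup>2 * \<omega> n \<le> 4 ^ k0 * (4 * \<rho> * \<omega> (2 ^ k0))"
        using doubling[of n] decseqD[OF dec less_imp_le[OF k0(2)]] rho_pos pos[of n]
        by (intro mult_mono) (auto intro: order_trans[OF doubling] mult_left_mono)
      then show ?thesis using pos[of n] pos[of "2 ^ k0"] by (simp add: level_weight_def field_simps)
    qed
    then have "(real n)\<^sup>2 * (\<rho> ^ j * level_weight k0) \<le> 4 * \<rho> / \<omega> n * \<rho> ^ j"
      using rho_pos by (metis mult.assoc mult.commute mult_right_mono less_imp_le zero_less_power)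
    finally show ?thesis by simp
  qed
  have "(real n)\<^sup>2 * dirichlet_weight K m = (\<Sum>k\<le>K. f k)"
    by (simp add: dirichlet_weight_def f_def sum_distrib_left)
  also have "\<dots> \<le> (\<Sum>k\<in>{..<k0} \<union> (\<lambda>j. k0 + j) ` {..K}. f k)"
  proof (rule sum_mono2)
    show "{..K} \<subseteq> {..<k0} \<union> (\<lambda>j. k0 + j) ` {..K}"
    proof
      fix k assume "k \<in> {..K}"
      then show "k \<in> {..<k0} \<union> (\<lambda>j. k0 + j) ` {..K}"
        by (cases "k < k0") (auto intro!: image_eqI[of _ _ "k - k0"])
    qed
  qed (use f0 in auto)
  also have "\<dots> = (\<Sum>k<k0. f k) + (\<Sum>j\<le>K. f (k0 + j))"
    by (subst sum.union_disjoint) (auto simp: sum.reindex)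
  also have "\<dots> \<le> (\<Sum>k<k0. 27 * 2 ^ k / (real n * \<omega> n)) + (\<Sum>j\<le>K. 4 * \<rho> / \<omega> n * \<rho> ^ j)"
    using low high by (intro add_mono sum_mono) auto
  also have "(\<Sum>k<k0. 27 * 2 ^ k / (real n * \<omega> n)) \<le> 54 / \<omega> n"
  proof -
    have "(\<Sum>k<k0. 27 * 2 ^ k / (real n * \<omega> n)) = 27 / (real n * \<omega> n) * (\<Sum>k<k0. 2 ^ k)"
      by (simp add: sum_distrib_left)
    also have "(\<Sum>k<k0. (2::real) ^ k) = 2 ^ k0 - 1" by (simp add: geometric_sum)
    also have "27 / (real n * \<omega> n) * (2 ^ k0 - 1) \<le> 27 / (real n * \<omega> n) * (2 * real n)"
    proof (rule mult_left_mono)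
      have "real (2 ^ k0) \<le> real (2 * n)" using k0(2) by (simp only: of_nat_le_iff)
      then show "(2::real) ^ k0 - 1 \<le> 2 * real n" by simp
    qed (use n pos[of n] in simp)
    also have "\<dots> = 54 / \<omega> n" using n by simp
    finally show ?thesis .
  qed
  also have "(\<Sum>j\<le>K. 4 * \<rho> / \<omega> n * \<rho> ^ j) \<le> 4 * \<rho> / \<omega> n * (1 / (1 - \<rho>))"
  proof -
    have "(\<Sum>j\<le>K. \<rho> ^ j) \<le> (\<Sum>j. \<rho> ^ j)"
      using rho_pos rho_less_1 by (intro sum_le_suminf summable_geometric) auto
    also have "\<dots> = 1 / (1 - \<rho>)" using rho_pos rho_less_1 by (intro suminf_geometric) auto
    finally show ?thesis
      unfolding sum_distrib_left[symmetric] using rho_pos pos[of n] by (intro mult_left_mono) auto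
  qed
  finally show ?thesis
    by (simp add: n_def dirichlet_const_def add_divide_distrib mult.commute)
qed

text \<open>The weighted sums are compared with \<open>\<Sum>k. level_weight k * \<integral>|f'(level_radius k * \<zeta>)|\<^sup>2\<close>,
  an expression that is monotone in the modulus of the derivative.\<close>
lemma dirichlet_contraction:
  fixes a b :: "nat \<Rightarrow> complex"
  assumes a: "summable (\<lambda>n. norm (of_nat (Suc n) * a (Suc n)))"
    and b: "summable (\<lambda>n. norm (of_nat (Suc n) * b (Suc n)))"
    and le: "\<And>z. norm z < 1 \<Longrightarrow>
      norm (\<Sum>n. of_nat (Suc n) * a (Suc n) * z ^ n) \<le> A * norm (\<Sum>n. of_nat (Suc n) * b (Suc n) * z ^ n)"
    and A: "0 \<le> A"
    and sb: "summable (\<lambda>n. (norm (b (Suc n)))\<^sup>2 / \<omega> (Suc n))"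
  shows "summable (\<lambda>n. (norm (a (Suc n)))\<^sup>2 / \<omega> (Suc n))"
    and "(\<Sum>n. (norm (a (Suc n)))\<^sup>2 / \<omega> (Suc n))
       \<le> 64 * A\<^sup>2 * dirichlet_const * (\<Sum>n. (norm (b (Suc n)))\<^sup>2 / \<omega> (Suc n))"
proof -
  define \<alpha> where "\<alpha> n = of_nat (Suc n) * a (Suc n)" for n
  \<comment> \<open>The factor A is absorbed into the coefficients of the second derivative, so that
    the majorization applies with constant 1 on every level circle.\<close>
  define \<beta> where "\<beta> n = of_real A * (of_nat (Suc n) * b (Suc n))" for n
  let ?r = level_radius
  have sum_r: "summable (\<lambda>n. norm (c n) * ?r k ^ n)" if "summable (\<lambda>n. norm (c n))" for c :: "nat \<Rightarrow> complex" and k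
    by (rule summable_comparison_test'[OF that])
       (use level_radius_bounds[of k] in \<open>auto simp: abs_mult intro!: mult_left_le power_le_one\<close>)
  have sa: "summable (\<lambda>n. norm (\<alpha> n))" using a by (simp add: \<alpha>_def)
  have s\<beta>: "summable (\<lambda>n. norm (\<beta> n))"
    using summable_mult[OF b, of A] A by (simp add: \<beta>_def norm_mult)
  have maj: "(\<Sum>n. (norm (\<alpha> n))\<^sup>2 * ?r k ^ (2 * n)) \<le> (\<Sum>n. (norm (\<beta> n))\<^sup>2 * ?r k ^ (2 * n))"
    and sma: "summable (\<lambda>n. (norm (\<alpha> n))\<^sup>2 * ?r k ^ (2 * n))"
    and smb: "summable (\<lambda>n. (norm (\<beta> n))\<^sup>2 * ?r k ^ (2 * n))" for k
  proof -
    have "norm (\<Sum>n. \<alpha> n * z ^ n) \<le> norm (\<Sum>n. \<beta> n * z ^ n)" if z: "norm z = ?r k" for z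
    proof -
      have "summable (\<lambda>n. of_nat (Suc n) * b (Suc n) * z ^ n)"
        by (rule summable_norm_cancel) (use sum_r[OF b, of k] z in \<open>simp add: norm_mult norm_power\<close>)
      then have "(\<Sum>n. \<beta> n * z ^ n) = of_real A * (\<Sum>n. of_nat (Suc n) * b (Suc n) * z ^ n)"
        by (simp add: \<beta>_def mult.assoc suminf_mult)
      then show ?thesis using le[of z] z level_radius_bounds[of k] A by (simp add: \<alpha>_def norm_mult)
    qed
    note cm = coefficient_majorization[OF level_radius_bounds(1) sum_r[OF sa] sum_r[OF s\<beta>] this]
    show "(\<Sum>n. (norm (\<alpha> n))\<^sup>2 * ?r k ^ (2 * n)) \<le> (\<Sum>n. (norm (\<beta> n))\<^sup>2 * ?r k ^ (2 * n))"
      "summable (\<lambda>n. (norm (\<alpha> n))\<^sup>2 * ?r k ^ (2 * n))"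
      using cm by auto
    show "summable (\<lambda>n. (norm (\<beta> n))\<^sup>2 * ?r k ^ (2 * n))"
      by (rule coefficient_majorization(2)[OF level_radius_bounds(1) sum_r[OF s\<beta>] sum_r[OF s\<beta>]]) simp
  qed
  define T where "T = A\<^sup>2 * dirichlet_const * (\<Sum>n. (norm (b (Suc n)))\<^sup>2 / \<omega> (Suc n))"
  have T: "(\<Sum>n. (norm (\<beta> n))\<^sup>2 * dirichlet_weight K n) \<le> T" for K
  proof -
    have t: "(norm (\<beta> n))\<^sup>2 * dirichlet_weight K n \<le> A\<^sup>2 * dirichlet_const * ((norm (b (Suc n)))\<^sup>2 / \<omega> (Suc n))" for n
    proof -
      have "(norm (\<beta> n))\<^sup>2 * dirichlet_weight K n
          = A\<^sup>2 * (norm (b (Suc n)))\<^sup>2 * ((real (Suc n))\<^sup>2 * dirichlet_weight K n)"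
        using A by (simp add: \<beta>_def norm_mult power_mult_distrib mult_ac del: of_nat_Suc)
      also have "\<dots> \<le> A\<^sup>2 * (norm (b (Suc n)))\<^sup>2 * (dirichlet_const / \<omega> (Suc n))"
        by (intro mult_left_mono dirichlet_weight_le) auto
      finally show ?thesis by (simp add: mult_ac)
    qed
    have "summable (\<lambda>n. (norm (\<beta> n))\<^sup>2 * dirichlet_weight K n)"
      unfolding dirichlet_weight_def sum_distrib_left
      by (intro summable_sum) (use summable_mult[OF smb] in \<open>simp add: mult_ac\<close>)
    then show ?thesis
      unfolding T_def suminf_mult[OF sb, symmetric]
      by (intro suminf_le t summable_mult sb)
  qed
  \<comment> \<open>The lower weight estimate needs a cutoff that grows with N, whereas the upper
    estimate T holds for every cutoff; hence the bound is uniform in N.\<close>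
  have partial: "(\<Sum>n<N. (norm (a (Suc n)))\<^sup>2 / \<omega> (Suc n)) \<le> 64 * T" for N
  proof -
    have "(\<Sum>n<N. (norm (a (Suc n)))\<^sup>2 / \<omega> (Suc n)) \<le> (\<Sum>n<N. 64 * ((norm (\<alpha> n))\<^sup>2 * dirichlet_weight (2 * N) n))"
    proof (rule sum_mono)
      fix n assume n: "n \<in> {..<N}"
      have "(norm (a (Suc n)))\<^sup>2 / \<omega> (Suc n) = 64 * (norm (a (Suc n)))\<^sup>2 * (1 / (64 * \<omega> (Suc n)))" by simp
      also have "\<dots> \<le> 64 * (norm (a (Suc n)))\<^sup>2 * ((real (Suc n))\<^sup>2 * dirichlet_weight (2 * N) n)"
        using n by (intro mult_left_mono dirichlet_weight_ge) auto
      also have "\<dots> = 64 * ((norm (\<alpha> n))\<^sup>2 * dirichlet_weight (2 * N) n)"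
        by (simp add: \<alpha>_def norm_mult power_mult_distrib mult_ac del: of_nat_Suc)
      finally show "(norm (a (Suc n)))\<^sup>2 / \<omega> (Suc n) \<le> 64 * ((norm (\<alpha> n))\<^sup>2 * dirichlet_weight (2 * N) n)" .
    qed
    also have "\<dots> = 64 * (\<Sum>k\<le>2*N. level_weight k * (\<Sum>n<N. (norm (\<alpha> n))\<^sup>2 * ?r k ^ (2 * n)))"
      unfolding dirichlet_weight_def sum_distrib_left by (subst sum.swap) (simp add: mult_ac)
    also have "\<dots> \<le> 64 * (\<Sum>k\<le>2*N. level_weight k * (\<Sum>n. (norm (\<beta> n))\<^sup>2 * ?r k ^ (2 * n)))"
    proof (intro mult_left_mono sum_mono)
      fix k
      have "(\<Sum>n<N. (norm (\<alpha> n))\<^sup>2 * ?r k ^ (2 * n)) \<le> (\<Sum>n. (norm (\<alpha> n))\<^sup>2 * ?r k ^ (2 * n))"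
        using sma level_radius_bounds[of k] by (intro sum_le_suminf) auto
      also note maj
      finally show "(\<Sum>n<N. (norm (\<alpha> n))\<^sup>2 * ?r k ^ (2 * n)) \<le> (\<Sum>n. (norm (\<beta> n))\<^sup>2 * ?r k ^ (2 * n))" .
    qed (use level_weight_pos in \<open>auto intro: less_imp_le\<close>)
    also have "(\<Sum>k\<le>2*N. level_weight k * (\<Sum>n. (norm (\<beta> n))\<^sup>2 * ?r k ^ (2 * n)))
        = (\<Sum>n. \<Sum>k\<le>2*N. level_weight k * ((norm (\<beta> n))\<^sup>2 * ?r k ^ (2 * n)))"
      by (subst suminf_sum) (auto intro!: summable_mult smb simp: suminf_mult[OF smb])
    also have "\<dots> = (\<Sum>n. (norm (\<beta> n))\<^sup>2 * dirichlet_weight (2 * N) n)"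
      unfolding dirichlet_weight_def sum_distrib_left by (simp add: mult_ac)
    finally show ?thesis using T[of "2 * N"] by simp
  qed
  have nonneg: "0 \<le> (norm (a (Suc n)))\<^sup>2 / \<omega> (Suc n)" for n
    using pos[of "Suc n"] by simp
  show "summable (\<lambda>n. (norm (a (Suc n)))\<^sup>2 / \<omega> (Suc n))"
    by (rule summableI_nonneg_bounded[OF nonneg partial])
  from suminf_le_const[OF this partial]
  show "(\<Sum>n. (norm (a (Suc n)))\<^sup>2 / \<omega> (Suc n))
       \<le> 64 * A\<^sup>2 * dirichlet_const * (\<Sum>n. (norm (b (Suc n)))\<^sup>2 / \<omega> (Suc n))"
    by (simp add: T_def mult_ac)
qed

end

section \<open>Potentials of almost extremal measures\<close>

text \<open>The Fourier coefficient of index -n; for a positive measure the one of index n is its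
  conjugate.\<close>

definition pmf_moment :: "complex pmf \<Rightarrow> nat \<Rightarrow> complex" where
  "pmf_moment p n = (LINT x|measure_pmf p. x ^ n)"

text \<open>For finitely supported measures, moments and potentials are finite sums over atoms.
  General measures on \<open>E\<close> reappear only as weak limits.\<close>

definition finite_pmfs :: "complex set \<Rightarrow> complex pmf set" where
  "finite_pmfs E = {p. finite (set_pmf p) \<and> set_pmf p \<subseteq> E}"

lemma pmf_moment_finite:
  "finite (set_pmf p) \<Longrightarrow> pmf_moment p n = (\<Sum>y\<in>set_pmf p. of_real (pmf p y) * y ^ n)"
  unfolding pmf_moment_def by (subst integral_measure_pmf[of "set_pmf p"]) (auto simp: scaleR_conv_of_real)

lemma sum_pmf_finite: "finite (set_pmf p) \<Longrightarrow> (\<Sum>y\<in>set_pmf p. pmf p y) = 1"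
  by (rule sum_pmf_eq_1) auto

lemma norm_pmf_moment_le_1:
  assumes "p \<in> finite_pmfs E" "E \<subseteq> unit_circle"
  shows "norm (pmf_moment p n) \<le> 1"
proof -
  have f: "finite (set_pmf p)" and c: "\<And>y. y \<in> set_pmf p \<Longrightarrow> norm y = 1"
    using assms by (auto simp: finite_pmfs_def)
  have "norm (pmf_moment p n) \<le> (\<Sum>y\<in>set_pmf p. norm (of_real (pmf p y) * y ^ n))"
    unfolding pmf_moment_finite[OF f] by (rule norm_sum)
  also have "\<dots> = (\<Sum>y\<in>set_pmf p. pmf p y)"
    by (intro sum.cong) (auto simp: norm_mult norm_power c)
  finally show ?thesis using sum_pmf_finite[OF f] by simp
qed

text \<open>The competitor (1 - t) p + t \<delta>(x) of the variational argument, realized by a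
  Bernoulli choice between \<open>p\<close> and the point mass at x.\<close>

lemma pmf_moment_mix:
  assumes p: "p \<in> finite_pmfs E" and x: "x \<in> E" and t: "0 \<le> t" "t \<le> 1"
  obtains q where "q \<in> finite_pmfs E" "\<And>n. pmf_moment q n = of_real (1 - t) * pmf_moment p n + of_real t * x ^ n"
proof
  define f where "f b = (if b then return_pmf x else p)" for b
  show "bind_pmf (bernoulli_pmf t) f \<in> finite_pmfs E"
    using p x unfolding finite_pmfs_def f_def by (auto split: if_splits)
  show "pmf_moment (bind_pmf (bernoulli_pmf t) f) n = of_real (1 - t) * pmf_moment p n + of_real t * x ^ n" for n
  proof -
    have "pmf_moment (bind_pmf (bernoulli_pmf t) f) n
        = (\<Sum>b\<in>UNIV. pmf (bernoulli_pmf t) b *\<^sub>R pmf_moment (f b) n)"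
      unfolding pmf_moment_def using p
      by (intro pmf_expectation_bind) (auto simp: f_def finite_pmfs_def)
    then show ?thesis
      using t by (simp add: UNIV_bool f_def pmf_moment_def scaleR_conv_of_real)
  qed
qed

text \<open>On the unit circle the real part of this one-sided series is the sum of \<omega>(|n|)
  r^|n| z^n over all integers n. The factor 2 for n > 0 folds the two signs together.\<close>

locale positive_kernel = doubling_weight +
  assumes kernel_positive: "\<And>r z. 0 \<le> r \<Longrightarrow> r < 1 \<Longrightarrow> norm z \<le> 1 \<Longrightarrow>
    0 \<le> Re (\<Sum>n. of_real ((if n = 0 then \<omega> 0 else 2 * \<omega> n) * r ^ n) * z ^ n)"
begin

definition kernel_coeff :: "real \<Rightarrow> nat \<Rightarrow> real" where
  "kernel_coeff r n = (if n = 0 then \<omega> 0 else 2 * \<omega> n) * r ^ n"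

text \<open>The double integral of the kernel against \<open>p\<close>, equivalently the sum of
  \<omega>(|n|) r^|n| times the squared moments over all integers.\<close>

definition energy :: "real \<Rightarrow> complex pmf \<Rightarrow> real" where
  "energy r p = (\<Sum>n. kernel_coeff r n * (norm (pmf_moment p n))\<^sup>2)"

text \<open>Taylor coefficients of the analytic function whose real part is the potential of
  \<open>p\<close>: integrating the kernel at \<open>cnj y * z\<close> over y produces the conjugate
  moments.\<close>

definition potential_coeff :: "real \<Rightarrow> complex pmf \<Rightarrow> nat \<Rightarrow> complex" where
  "potential_coeff r p n = of_real (kernel_coeff r n) * cnj (pmf_moment p n)"

lemma kernel_coeff_nonneg: "0 \<le> r \<Longrightarrow> 0 \<le> kernel_coeff r n"
  using pos[of n] pos[of 0] by (simp add: kernel_coeff_def)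

lemma kernel_coeff_le: "0 \<le> r \<Longrightarrow> kernel_coeff r n \<le> 2 * \<omega> 0 * r ^ n"
  using decseqD[OF dec, of 0 n] pos[of 0] by (auto simp: kernel_coeff_def intro!: mult_right_mono)

text \<open>Radii s beyond 1, up to but excluding 1/r, are included on purpose: the potentials must
  be analytic across the unit circle.\<close>

lemma summable_kernel_coeff:
  assumes "0 \<le> r" "0 \<le> s" "r * s < 1"
  shows "summable (\<lambda>n. kernel_coeff r n * s ^ n)"
proof (rule summable_comparison_test')
  show "summable (\<lambda>n. 2 * \<omega> 0 * (r * s) ^ n)"
    using assms by (intro summable_mult summable_geometric) auto
  fix n :: nat
  show "norm (kernel_coeff r n * s ^ n) \<le> 2 * \<omega> 0 * (r * s) ^ n"
    using mult_right_mono[OF kernel_coeff_le[OF assms(1), of n], of "s ^ n"] assms kernel_coeff_nonneg[of r n]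
    by (simp add: abs_mult power_mult_distrib mult.assoc)
qed

context
  fixes E and p and r :: real
  assumes E: "E \<subseteq> unit_circle" and p: "p \<in> finite_pmfs E" and r: "0 < r" "r < 1"
begin

lemma norm_potential_coeff_le: "norm (potential_coeff r p n) \<le> kernel_coeff r n"
  using norm_pmf_moment_le_1[OF p E, of n] kernel_coeff_nonneg[of r n] r
  by (simp add: potential_coeff_def norm_mult mult_left_le)

lemma summable_potential_coeff:
  assumes "0 \<le> s" "r * s < 1"
  shows "summable (\<lambda>n. norm (potential_coeff r p n) * s ^ n)"
proof (rule summable_comparison_test'[OF summable_kernel_coeff[of r s]])
  show "norm (norm (potential_coeff r p n) * s ^ n) \<le> kernel_coeff r n * s ^ n" for n
    using norm_potential_coeff_le[of n] assms by (simp add: abs_mult mult_right_mono)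
qed (use assms r in auto)

lemma summable_potential: "norm z \<le> 1 \<Longrightarrow> summable (\<lambda>n. potential_coeff r p n * z ^ n)"
  by (rule summable_norm_cancel, rule summable_comparison_test'[OF summable_potential_coeff[of 1]])
     (use r in \<open>auto simp: norm_mult norm_power intro!: mult_left_le power_le_one\<close>)

lemma summable_energy: "summable (\<lambda>n. kernel_coeff r n * (norm (pmf_moment p n))\<^sup>2)"
proof (rule summable_comparison_test'[OF summable_kernel_coeff[of r 1]])
  show "norm (kernel_coeff r n * (norm (pmf_moment p n))\<^sup>2) \<le> kernel_coeff r n * 1 ^ n" for n
    using norm_pmf_moment_le_1[OF p E, of n] kernel_coeff_nonneg[of r n] r
    by (simp add: abs_mult mult_left_le power_le_one)
qed (use r in auto)

text \<open>The potential is a convex combination, over the atoms y, of kernels at the points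
  \<open>cnj y * z\<close>, which stay in the closed disc because |y| = 1.\<close>

lemma potential_nonneg:
  assumes z: "norm z \<le> 1"
  shows "0 \<le> Re (\<Sum>n. potential_coeff r p n * z ^ n)"
proof -
  have f: "finite (set_pmf p)" and c: "\<And>y. y \<in> set_pmf p \<Longrightarrow> norm y = 1"
    using p E by (auto simp: finite_pmfs_def)
  have s: "summable (\<lambda>n. of_real (kernel_coeff r n) * (cnj y * z) ^ n)" if "y \<in> set_pmf p" for y
    by (rule summable_norm_cancel, rule summable_comparison_test'[OF summable_kernel_coeff[of r 1]])
       (use r z kernel_coeff_nonneg[of r] c[OF that] in
          \<open>auto simp: norm_mult norm_power power_mult_distrib intro!: mult_left_le power_le_one\<close>)
  have "(\<Sum>n. potential_coeff r p n * z ^ n)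
      = (\<Sum>n. \<Sum>y\<in>set_pmf p. of_real (pmf p y) * (of_real (kernel_coeff r n) * (cnj y * z) ^ n))"
    by (simp add: potential_coeff_def pmf_moment_finite[OF f] sum_distrib_left sum_distrib_right
        power_mult_distrib mult_ac)
  also have "\<dots> = (\<Sum>y\<in>set_pmf p. of_real (pmf p y) * (\<Sum>n. of_real (kernel_coeff r n) * (cnj y * z) ^ n))"
    by (subst suminf_sum) (auto intro!: summable_mult s simp: suminf_mult[OF s])
  finally have "Re (\<Sum>n. potential_coeff r p n * z ^ n)
      = (\<Sum>y\<in>set_pmf p. pmf p y * Re (\<Sum>n. of_real (kernel_coeff r n) * (cnj y * z) ^ n))"
    by simp
  also have "\<dots> \<ge> 0"
    using kernel_positive[of r] r z c
    by (intro sum_nonneg mult_nonneg_nonneg) (auto simp: kernel_coeff_def norm_mult)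
  finally show ?thesis .
qed

text \<open>The energy is a quadratic form: the cross term is the potential of \<open>p\<close> at
  x, and the last sum is the energy of a point mass, all of whose moments have modulus 1.\<close>

lemma energy_mix:
  assumes x: "x \<in> E" and q: "q \<in> finite_pmfs E"
    and mom: "\<And>n. pmf_moment q n = of_real (1 - t) * pmf_moment p n + of_real t * x ^ n"
  shows "energy r q = (1 - t)\<^sup>2 * energy r p + 2 * t * (1 - t) * Re (\<Sum>n. potential_coeff r p n * x ^ n)
           + t\<^sup>2 * (\<Sum>n. kernel_coeff r n)"
proof -
  have nx: "norm x = 1" using x E by auto
  have sq: "(norm (of_real a * u + of_real b * v))\<^sup>2 = a\<^sup>2 * (norm u)\<^sup>2 + 2 * b * a * Re (cnj u * v) + b\<^sup>2 * (norm v)\<^sup>2"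
    for a b :: real and u v :: complex
    unfolding cmod_power2 by (simp add: power2_eq_square algebra_simps)
  have "kernel_coeff r n * (norm (pmf_moment q n))\<^sup>2 =
      (1 - t)\<^sup>2 * (kernel_coeff r n * (norm (pmf_moment p n))\<^sup>2)
      + 2 * t * (1 - t) * Re (potential_coeff r p n * x ^ n) + t\<^sup>2 * kernel_coeff r n" for n
    unfolding mom sq by (simp add: potential_coeff_def norm_power nx algebra_simps)
  moreover have "(\<lambda>n. (1 - t)\<^sup>2 * (kernel_coeff r n * (norm (pmf_moment p n))\<^sup>2)
      + 2 * t * (1 - t) * Re (potential_coeff r p n * x ^ n) + t\<^sup>2 * kernel_coeff r n) sums
      ((1 - t)\<^sup>2 * energy r p + 2 * t * (1 - t) * Re (\<Sum>n. potential_coeff r p n * x ^ n)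
           + t\<^sup>2 * (\<Sum>n. kernel_coeff r n))"
    unfolding energy_def using summable_kernel_coeff[of r 1] r nx
    by (intro sums_add sums_mult sums_Re summable_sums summable_energy summable_potential) auto
  ultimately show ?thesis
    unfolding energy_def by (simp add: sums_iff)
qed

end

text \<open>An approximate minimizer of the energy suffices: moving a small mass \<open>t\<close> to a point \<open>x\<close>
  cannot lower the energy much, which bounds the potential at \<open>x\<close> from below.\<close>
lemma exists_large_potential:
  assumes E: "E \<subseteq> unit_circle" "E \<noteq> {}" and r: "0 < r" "r < 1" and M: "0 < M"
    and low: "\<And>p. p \<in> finite_pmfs E \<Longrightarrow> M \<le> energy r p"
  obtains p where "p \<in> finite_pmfs E"
    "\<And>x. x \<in> E \<Longrightarrow> energy r p / 2 \<le> Re (\<Sum>n. potential_coeff r p n * x ^ n)"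
proof -
  define I where "I = (INF p\<in>finite_pmfs E. energy r p)"
  define H where "H = (\<Sum>n. kernel_coeff r n)"
  have H: "0 \<le> H"
    unfolding H_def using summable_kernel_coeff[of r 1] r kernel_coeff_nonneg[of r] by (intro suminf_nonneg) auto
  \<comment> \<open>Small enough that the quadratic cost t^2 H of the added point mass is at most t
    M / 2. The bound 1/2 keeps t < 1, and H + 1 avoids a zero denominator.\<close>
  define t where "t = min (1/2) (M / (2 * (H + 1)))"
  have t: "0 < t" "t < 1" "t * H \<le> M / 2"
  proof -
    show "0 < t" "t < 1" using M H by (auto simp: t_def)
    have "t * H \<le> M / (2 * (H + 1)) * H" using H by (intro mult_right_mono) (auto simp: t_def)
    also have "\<dots> \<le> M / 2" using H M by (simp add: field_simps)
    finally show "t * H \<le> M / 2" .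
  qed
  \<comment> \<open>The tolerance of the near-minimizer uses up the other half of t M, so a small
    potential at x would give t * \<open>energy r p\<close> < t M, below the assumed
    minimum.\<close>
  define \<eta> where "\<eta> = t * M / 2"
  have \<eta>: "0 < \<eta>" using t M by (simp add: \<eta>_def)
  obtain e where e: "e \<in> E" using E by blast
  have ne: "finite_pmfs E \<noteq> {}"
  proof -
    have "return_pmf e \<in> finite_pmfs E" using e by (simp add: finite_pmfs_def)
    then show ?thesis by blast
  qed
  have bdd: "bdd_below (energy r ` finite_pmfs E)" using low by (auto intro!: bdd_belowI[of _ M])
  have "\<exists>y\<in>energy r ` finite_pmfs E. y < I + \<eta>"
    by (rule cInf_lessD) (use ne \<eta> in \<open>auto simp: I_def\<close>)
  then obtain p where p: "p \<in> finite_pmfs E" "energy r p < I + \<eta>" by blast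
  show thesis
  proof (rule that[OF p(1)], rule ccontr)
    fix x assume x: "x \<in> E"
    define U where "U = Re (\<Sum>n. potential_coeff r p n * x ^ n)"
    assume "\<not> energy r p / 2 \<le> Re (\<Sum>n. potential_coeff r p n * x ^ n)"
    then have U: "2 * U \<le> energy r p" by (simp add: U_def)
    obtain q where q: "q \<in> finite_pmfs E" "\<And>n. pmf_moment q n = of_real (1 - t) * pmf_moment p n + of_real t * x ^ n"
      using pmf_moment_mix[OF p(1) x, of t] t by auto
    have "I \<le> energy r q" unfolding I_def by (rule cINF_lower[OF bdd q(1)])
    also have "energy r q = (1 - t)\<^sup>2 * energy r p + t * (1 - t) * (2 * U) + t * (t * H)"
      unfolding energy_mix[OF E(1) p(1) r x q] U_def H_def by (simp add: power2_eq_square)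
    also have "\<dots> \<le> (1 - t)\<^sup>2 * energy r p + t * (1 - t) * energy r p + t * (M / 2)"
      using t U by (intro add_mono mult_left_mono) auto
    also have "\<dots> = energy r p - t * energy r p + t * M / 2"
      by (simp add: power2_eq_square algebra_simps)
    finally have "t * energy r p < \<eta> + t * M / 2" using p(2) by simp
    then have "t * energy r p < t * M" by (simp add: \<eta>_def mult.commute)
    then show False using low[OF p(1)] t by simp
  qed
qed

text \<open>Dividing the potential by half the energy I makes it at least 1 on \<open>E\<close>. Its
  coefficients then have square norm, in the dual weight 1 / \<omega>, at most (8 / I^2) I = 8 / I:
  the dual norm of a potential is again an energy.\<close>

lemma exists_potential_series:
  assumes E: "E \<subseteq> unit_circle" "E \<noteq> {}" and r: "0 < r" "r < 1" and M: "0 < M"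
    and low: "\<And>p. p \<in> finite_pmfs E \<Longrightarrow> M \<le> energy r p"
  obtains R :: real and b :: "nat \<Rightarrow> complex" and \<beta> :: real where
    "1 < R" "summable (\<lambda>n. norm (b n) * R ^ n)"
    "\<And>z. norm z \<le> 1 \<Longrightarrow> 0 \<le> Re (\<Sum>n. b n * z ^ n)"
    "\<And>x. x \<in> E \<Longrightarrow> 1 \<le> Re (\<Sum>n. b n * x ^ n)"
    "b 0 = of_real \<beta>" "0 \<le> \<beta>" "\<beta> \<le> 2 * \<omega> 0 / M"
    "summable (\<lambda>n. (norm (b (Suc n)))\<^sup>2 / \<omega> (Suc n))"
    "(\<Sum>n. (norm (b (Suc n)))\<^sup>2 / \<omega> (Suc n)) \<le> 8 / M"
proof -
  obtain p where p: "p \<in> finite_pmfs E"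
    "\<And>x. x \<in> E \<Longrightarrow> energy r p / 2 \<le> Re (\<Sum>n. potential_coeff r p n * x ^ n)"
    using exists_large_potential[OF E r M low] by blast
  define I where "I = energy r p"
  have I: "M \<le> I" "0 < I" using low[OF p(1)] M by (auto simp: I_def)
  define b where "b n = of_real (2 / I) * potential_coeff r p n" for n
  have bser: "(\<Sum>n. b n * z ^ n) = of_real (2 / I) * (\<Sum>n. potential_coeff r p n * z ^ n)" if "norm z \<le> 1" for z
    unfolding b_def mult.assoc by (rule suminf_mult[OF summable_potential[OF E(1) p(1) r that]])
  have Re_bser: "Re (\<Sum>n. b n * z ^ n) = 2 / I * Re (\<Sum>n. potential_coeff r p n * z ^ n)" if "norm z \<le> 1" for z
  proof -
    have "Re (of_real c * w) = c * Re w" for c :: real and w by simp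
    then show ?thesis unfolding bser[OF that] .
  qed
  have m0: "pmf_moment p 0 = 1" by (simp add: pmf_moment_def)
  have le: "(norm (b (Suc n)))\<^sup>2 / \<omega> (Suc n)
      \<le> 8 / I\<^sup>2 * (kernel_coeff r (Suc n) * (norm (pmf_moment p (Suc n)))\<^sup>2)" for n
  proof -
    have "(norm (b (Suc n)))\<^sup>2 / \<omega> (Suc n)
        = 16 / I\<^sup>2 * \<omega> (Suc n) * (r ^ Suc n * r ^ Suc n) * (norm (pmf_moment p (Suc n)))\<^sup>2"
      using I pos[of "Suc n"] r
      by (simp add: b_def potential_coeff_def kernel_coeff_def norm_mult norm_divide norm_power abs_mult power2_eq_square field_simps)
    \<comment> \<open>One of the two factors r^n is dropped, so that the remaining 2 \<omega>(n) r^n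
      is a kernel coefficient and the sum is bounded by the energy.\<close>
    also have "\<dots> \<le> 16 / I\<^sup>2 * \<omega> (Suc n) * (r ^ Suc n * 1) * (norm (pmf_moment p (Suc n)))\<^sup>2"
      using r pos[of "Suc n"] by (intro mult_right_mono mult_left_mono power_le_one) auto
    finally show ?thesis by (simp add: kernel_coeff_def)
  qed
  have se: "summable (\<lambda>n. 8 / I\<^sup>2 * (kernel_coeff r (Suc n) * (norm (pmf_moment p (Suc n)))\<^sup>2))"
    using summable_energy[OF E(1) p(1) r] by (intro summable_mult) (subst summable_Suc_iff)
  have nonneg: "0 \<le> (norm (b (Suc n)))\<^sup>2 / \<omega> (Suc n)" for n using pos[of "Suc n"] by simp
  have sb: "summable (\<lambda>n. (norm (b (Suc n)))\<^sup>2 / \<omega> (Suc n))"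
    by (rule summable_comparison_test'[OF se]) (use le nonneg in \<open>simp only: real_norm_def abs_of_nonneg\<close>)
  \<comment> \<open>The midpoint of 1 and 1/r, so that r R = (1 + r) / 2 < 1.\<close>
  define R where "R = (1 + 1 / r) / 2"
  have R: "1 < R" "r * R < 1" using r by (auto simp: R_def field_simps)
  show thesis
  proof (rule that[of R b "2 / I * \<omega> 0"])
    show "1 < R" by fact
    show "summable (\<lambda>n. norm (b n) * R ^ n)"
      using summable_mult[OF summable_potential_coeff[OF E(1) p(1) r, of R], of "2 / I"] R I
      by (simp add: b_def norm_mult norm_divide mult.assoc)
    show "0 \<le> Re (\<Sum>n. b n * z ^ n)" if "norm z \<le> 1" for z
      unfolding Re_bser[OF that] using potential_nonneg[OF E(1) p(1) r that] I by simp
    show "1 \<le> Re (\<Sum>n. b n * x ^ n)" if "x \<in> E" for x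
    proof -
      have "norm x \<le> 1" using that E by auto
      then show ?thesis unfolding Re_bser[OF \<open>norm x \<le> 1\<close>]
        using p(2)[OF that] I by (simp add: I_def[symmetric] field_simps)
    qed
    show "b 0 = of_real (2 / I * \<omega> 0)" by (simp add: b_def potential_coeff_def kernel_coeff_def m0)
    show "0 \<le> 2 / I * \<omega> 0" using I pos[of 0] by simp
    show "2 / I * \<omega> 0 \<le> 2 * \<omega> 0 / M" using I M pos[of 0] by (simp add: field_simps)
    show "summable (\<lambda>n. (norm (b (Suc n)))\<^sup>2 / \<omega> (Suc n))" by fact
    define S where "S = (\<Sum>n. kernel_coeff r (Suc n) * (norm (pmf_moment p (Suc n)))\<^sup>2)"
    have sk: "summable (\<lambda>n. kernel_coeff r (Suc n) * (norm (pmf_moment p (Suc n)))\<^sup>2)"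
      using summable_energy[OF E(1) p(1) r] by (subst summable_Suc_iff)
    have "S \<le> I"
      unfolding S_def I_def energy_def
      using suminf_split_head[OF summable_energy[OF E(1) p(1) r]] kernel_coeff_nonneg[of r 0] r by simp
    have "(\<Sum>n. (norm (b (Suc n)))\<^sup>2 / \<omega> (Suc n)) \<le> 8 / I\<^sup>2 * S"
      using suminf_le[OF le sb se] unfolding suminf_mult[OF sk] S_def .
    also have "\<dots> \<le> 8 / I\<^sup>2 * I"
      using \<open>S \<le> I\<close> by (intro mult_left_mono) auto
    also have "\<dots> = 8 / I" using I by (simp add: power2_eq_square)
    also have "8 / I \<le> 8 / M" using I M by (simp add: field_simps)
    finally show "(\<Sum>n. (norm (b (Suc n)))\<^sup>2 / \<omega> (Suc n)) \<le> 8 / M" .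
  qed
qed

text \<open>The series is that of g = exp(-A h). Since |g| \<le> 1 on the disc, |g'| \<le> A |h'|,
  and the dual norm grows at most as \<open>dirichlet_contraction\<close> allows. The constant 512
  is its 64 times the 8 from the potential.\<close>

lemma exists_test_series:
  assumes E: "E \<subseteq> unit_circle" "E \<noteq> {}" and r: "0 < r" "r < 1" and M: "0 < M"
    and low: "\<And>p. p \<in> finite_pmfs E \<Longrightarrow> M \<le> energy r p" and A: "0 \<le> A"
  obtains a :: "nat \<Rightarrow> complex" and \<beta> :: real where
    "summable (\<lambda>n. norm (a n))"
    "\<And>x. x \<in> E \<Longrightarrow> norm (\<Sum>n. a n * x ^ n) \<le> exp (- A)"
    "a 0 = of_real (exp (- A * \<beta>))" "0 \<le> \<beta>" "\<beta> \<le> 2 * \<omega> 0 / M"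
    "summable (\<lambda>n. (norm (a (Suc n)))\<^sup>2 / \<omega> (Suc n))"
    "(\<Sum>n. (norm (a (Suc n)))\<^sup>2 / \<omega> (Suc n)) \<le> 512 * A\<^sup>2 * dirichlet_const / M"
proof -
  obtain R :: real and b :: "nat \<Rightarrow> complex" and \<beta> :: real where
    R: "1 < R" and sR: "summable (\<lambda>n. norm (b n) * R ^ n)" and
    Re0: "\<And>z. norm z \<le> 1 \<Longrightarrow> 0 \<le> Re (\<Sum>n. b n * z ^ n)" and
    Re1: "\<And>x. x \<in> E \<Longrightarrow> 1 \<le> Re (\<Sum>n. b n * x ^ n)" and
    \<beta>: "b 0 = of_real \<beta>" "0 \<le> \<beta>" "\<beta> \<le> 2 * \<omega> 0 / M" and
    sb: "summable (\<lambda>n. (norm (b (Suc n)))\<^sup>2 / \<omega> (Suc n))"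
      "(\<Sum>n. (norm (b (Suc n)))\<^sup>2 / \<omega> (Suc n)) \<le> 8 / M"
    by (rule exists_potential_series[OF E r M], erule low) (rule that)
  define h where "h z = (\<Sum>n. b n * z ^ n)" for z
  define g where "g z = exp (- of_real A * h z)" for z
  have sb_R: "summable (\<lambda>n. b n * of_real R ^ n)"
    by (rule summable_norm_cancel) (use sR R in \<open>simp add: norm_mult norm_power\<close>)
  have nR: "norm (of_real R :: complex) = R" using R by simp
  have dh: "(h has_field_derivative (\<Sum>n. diffs b n * z ^ n)) (at z)" if "norm z < R" for z
    unfolding h_def using termdiffs_strong[OF sb_R, of z] that nR by simp
  have dg: "(g has_field_derivative (g z * (- of_real A * (\<Sum>n. diffs b n * z ^ n)))) (at z)" if "norm z < R" for z
    unfolding g_def using dh[OF that] by (auto intro!: derivative_eq_intros)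
  have hol: "g holomorphic_on ball 0 R"
    unfolding holomorphic_on_def field_differentiable_def
  proof
    fix z :: complex assume "z \<in> ball 0 R"
    then have "norm z < R" by simp
    from has_field_derivative_at_within[OF dg[OF this]]
    show "\<exists>f'. (g has_field_derivative f') (at z within ball 0 R)" by blast
  qed
  define a where "a n = (deriv ^^ n) g 0 / fact n" for n
  have ga: "(\<lambda>n. a n * z ^ n) sums g z" if "norm z < R" for z
    using holomorphic_power_series[OF hol, of z] that by (simp add: a_def)
  \<comment> \<open>An intermediate radius: convergence at some point of modulus above 1 gives
    absolute convergence on the unit circle for the series and for their derivatives.\<close>
  define R' where "R' = (1 + R) / 2"
  have R': "1 < R'" "R' < R" using R by (auto simp: R'_def)
  have sa_R': "summable (\<lambda>n. a n * of_real R' ^ n)"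
    using ga[of "of_real R'"] R' by (auto intro: sums_summable)
  have s_norm: "summable (\<lambda>n. norm (c n))" if "summable (\<lambda>n. c n * of_real R' ^ n)" for c :: "nat \<Rightarrow> complex"
    using powser_insidea[OF that, of 1] R' by simp
  have s_diffs: "summable (\<lambda>n. diffs c n * of_real R' ^ n)" if "\<And>z. norm z < R \<Longrightarrow> summable (\<lambda>n. c n * z ^ n)"
    for c :: "nat \<Rightarrow> complex"
    by (rule termdiff_converges[of _ R]) (use that R' in auto)
  have sum_b: "summable (\<lambda>n. b n * z ^ n)" if "norm z < R" for z
    using powser_inside[OF sb_R, of z] that nR by simp
  have da: "norm (diffs a n) = norm (of_nat (Suc n) * a (Suc n))"
    and db: "norm (diffs b n) = norm (of_nat (Suc n) * b (Suc n))" for n by (simp_all add: diffs_def)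
  have contr: "norm (\<Sum>n. of_nat (Suc n) * a (Suc n) * z ^ n) \<le> A * norm (\<Sum>n. of_nat (Suc n) * b (Suc n) * z ^ n)"
    if z: "norm z < 1" for z
  proof -
    have zR: "norm z < R" "norm z < R'" using z R R' by auto
    have "((\<lambda>z. \<Sum>n. a n * z ^ n) has_field_derivative (\<Sum>n. diffs a n * z ^ n)) (at z)"
      using termdiffs_strong[OF sa_R', of z] zR R' by simp
    moreover have "((\<lambda>z. \<Sum>n. a n * z ^ n) has_field_derivative (g z * (- of_real A * (\<Sum>n. diffs b n * z ^ n)))) (at z)"
      by (rule has_field_derivative_transform_within_open[OF dg[OF zR(1)], of "ball 0 R"])
         (use zR ga in \<open>auto simp: sums_iff\<close>)
    ultimately have "(\<Sum>n. diffs a n * z ^ n) = g z * (- of_real A * (\<Sum>n. diffs b n * z ^ n))"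
      by (rule DERIV_unique)
    \<comment> \<open>This is where positivity of the kernel inside the whole disc, and not just on
      \<open>E\<close>, is used.\<close>
    moreover have "norm (g z) \<le> 1"
      using Re0[of z] z A by (simp add: g_def h_def)
    ultimately have "norm (\<Sum>n. diffs a n * z ^ n) \<le> A * norm (\<Sum>n. diffs b n * z ^ n)"
      using A by (simp add: norm_mult mult_left_le_one_le)
    then show ?thesis by (simp add: diffs_def)
  qed
  have sa': "summable (\<lambda>n. norm (of_nat (Suc n) * a (Suc n)))"
    using s_norm[OF s_diffs[of a]] ga by (auto simp only: da intro: sums_summable)
  have sb': "summable (\<lambda>n. norm (of_nat (Suc n) * b (Suc n)))"
    using s_norm[OF s_diffs[of b]] sum_b by (auto simp only: db)
  note dc = dirichlet_contraction[OF sa' sb' contr A sb(1)]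
  show thesis
  proof (rule that[of a \<beta>])
    show "summable (\<lambda>n. norm (a n))" by (rule s_norm[OF sa_R'])
    show "norm (\<Sum>n. a n * x ^ n) \<le> exp (- A)" if "x \<in> E" for x
    proof -
      have "norm x < R" using that E R by auto
      then have "(\<Sum>n. a n * x ^ n) = g x" using ga by (simp add: sums_iff)
      then show ?thesis using Re1[OF that] A by (simp add: g_def h_def mult_le_cancel_left1)
    qed
    show "a 0 = of_real (exp (- A * \<beta>))"
      by (simp add: a_def g_def h_def \<beta>(1) exp_of_real flip: of_real_mult of_real_minus)
    show "0 \<le> \<beta>" "\<beta> \<le> 2 * \<omega> 0 / M" by fact+
    show "summable (\<lambda>n. (norm (a (Suc n)))\<^sup>2 / \<omega> (Suc n))" by (rule dc(1))
    have "64 * A\<^sup>2 * dirichlet_const * (\<Sum>n. (norm (b (Suc n)))\<^sup>2 / \<omega> (Suc n)) \<le> 64 * A\<^sup>2 * dirichlet_const * (8 / M)"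
      using sb(2) dirichlet_const_nonneg by (intro mult_left_mono) auto
    then show "(\<Sum>n. (norm (a (Suc n)))\<^sup>2 / \<omega> (Suc n)) \<le> 512 * A\<^sup>2 * dirichlet_const / M"
      using dc(2) by simp
  qed
qed

end

section \<open>Moment sequences as positive kernels\<close>

text \<open>The full sum is (1 + v) / (1 - v), the Poisson kernel up to its real part, which is
  nonnegative; the lower bound is minus the modulus of the tail. The truncated form lets the sum be
  exchanged with an integral without a limit theorem.\<close>

lemma Re_geometric_kernel_ge:
  fixes v :: complex
  assumes v: "norm v \<le> r" and r: "r < 1" and N: "0 < N"
  shows "- (2 * r ^ N / (1 - r)) \<le> Re (\<Sum>n<N. (if n = 0 then 1 else 2) * v ^ n)"
proof -
  have v1: "norm v < 1" "v \<noteq> 1" using v r by auto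
  have r0: "0 \<le> r" using v norm_ge_zero order_trans by blast
  have "(\<Sum>n<N. (if n = 0 then 1 else 2) * v ^ n) = (\<Sum>n<N. 2 * v ^ n - (if n = 0 then 1 else 0))"
    by (intro sum.cong) auto
  also have "\<dots> = 2 * (\<Sum>n<N. v ^ n) - 1"
    using N by (simp add: sum_subtractf sum_distrib_left)
  also have "(\<Sum>n<N. v ^ n) = (1 - v ^ N) / (1 - v)"
    using v1 geometric_sum[of v N] by (simp add: field_simps)
  also have "2 * ((1 - v ^ N) / (1 - v)) - 1 = (1 + v) / (1 - v) - 2 * v ^ N / (1 - v)"
  proof -
    have "1 - v \<noteq> 0" using v1 by simp
    then have "2 * ((1 - v ^ N) / (1 - v)) - 1 = (2 * (1 - v ^ N) - (1 - v)) / (1 - v)"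
      by (subst diff_divide_distrib) simp
    also have "2 * (1 - v ^ N) - (1 - v) = (1 + v) - 2 * v ^ N" by simp
    finally show ?thesis by (simp add: diff_divide_distrib)
  qed
  finally have eq: "(\<Sum>n<N. (if n = 0 then 1 else 2) * v ^ n) = (1 + v) / (1 - v) - 2 * v ^ N / (1 - v)" .
  have "0 \<le> Re ((1 + v) / (1 - v))"
  proof -
    have "(norm v)\<^sup>2 \<le> 1" using v1 by (simp add: power_le_one)
    then have "0 \<le> (1 + Re v) * (1 - Re v) + Im v * (- Im v)"
      unfolding cmod_power2 by (simp add: power2_eq_square algebra_simps)
    then show ?thesis by (simp add: Re_divide)
  qed
  moreover have "norm (2 * v ^ N / (1 - v)) \<le> 2 * r ^ N / (1 - r)"
  proof -
    have "1 - r \<le> norm (1 - v)" using norm_triangle_ineq2[of 1 v] v by simp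
    then show ?thesis
      unfolding norm_divide norm_mult norm_power using v r r0
      by (intro frac_le mult_mono power_mono) auto
  qed
  moreover have "Re (2 * v ^ N / (1 - v)) \<le> norm (2 * v ^ N / (1 - v))" by (rule complex_Re_le_cmod)
  ultimately show ?thesis unfolding eq by simp
qed

section \<open>Moments of a weight\<close>

context
  fixes W :: "real \<Rightarrow> real"
  assumes W: "weight W"
begin

lemma weight_nonneg: "0 < t \<Longrightarrow> t \<le> 1 \<Longrightarrow> 0 \<le> W t"
  using W by (auto simp: weight_def)

lemma integrable_weight: "integrable lborel (\<lambda>t. indicator {0<..1} t *\<^sub>R W t)"
  using W by (auto simp: weight_def set_integrable_def)

lemma integrable_weight_mult:
  fixes f :: "real \<Rightarrow> real"
  assumes f: "continuous_on UNIV f" "\<And>t. 0 < t \<Longrightarrow> t \<le> 1 \<Longrightarrow> \<bar>f t\<bar> \<le> 1"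
  shows "integrable lborel (\<lambda>t. indicator {0<..1} t *\<^sub>R (f t * W t))"
proof (rule Bochner_Integration.integrable_bound[OF integrable_weight])
  have "(\<lambda>t. f t * (indicator {0<..1} t *\<^sub>R W t)) \<in> borel_measurable lborel"
    using borel_measurable_integrable[OF integrable_weight] borel_measurable_continuous_onI[OF f(1)]
    by (intro borel_measurable_times) auto
  then show "(\<lambda>t. indicator {0<..1} t *\<^sub>R (f t * W t)) \<in> borel_measurable lborel"
    by (simp add: mult_ac)
  show "AE t in lborel. norm (indicator {0<..1} t *\<^sub>R (f t * W t)) \<le> norm (indicator {0<..1} t *\<^sub>R W t)"
    using f(2) by (auto split: split_indicator simp: abs_mult intro!: mult_left_le_one_le)
qed

lemma moment_integrable: "integrable lborel (\<lambda>t. indicator {0<..1} t *\<^sub>R ((1 - t) ^ n * W t))"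
  by (rule integrable_weight_mult) (auto intro!: continuous_intros power_le_one simp: abs_mult power_abs)

lemma moment_alt: "moment W n = (LINT t|lborel. indicator {0<..1} t *\<^sub>R ((1 - t) ^ n * W t))"
  unfolding moment_def set_lebesgue_integral_def
  by (subst lborel_integral_real_affine[where c = "-1" and t = 1])
     (auto intro!: Bochner_Integration.integral_cong split: split_indicator)

lemma moment_nonneg: "0 \<le> moment W n"
  unfolding moment_alt using weight_nonneg
  by (intro Bochner_Integration.integral_nonneg) (auto split: split_indicator)

lemma decseq_moment: "decseq (moment W)"
proof (rule decseq_SucI)
  show "moment W (Suc n) \<le> moment W n" for n
    unfolding moment_alt using weight_nonneg
    by (intro integral_mono moment_integrable)
       (auto split: split_indicator intro!: mult_right_mono mult_left_le_one_le)
qed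

text \<open>A vanishing moment makes W zero almost everywhere, and then the integral in
  \<open>condition_C2\<close> would be 0 instead of infinite.\<close>

lemma moment_pos:
  assumes C2: "condition_C2 W"
  shows "0 < moment W n"
proof (rule ccontr)
  assume "\<not> 0 < moment W n"
  then have "moment W n = 0" using moment_nonneg[of n] by simp
  then have "AE t in lborel. indicator {0<..1} t *\<^sub>R ((1 - t) ^ n * W t) = 0"
    unfolding moment_alt using weight_nonneg
    by (subst (asm) integral_nonneg_eq_0_iff_AE[OF moment_integrable]) (auto split: split_indicator)
  \<comment> \<open>At t = 1 the factor (1 - t)^n may vanish and says nothing about W, so this point
    is removed.\<close>
  moreover have "AE t in lborel. t \<noteq> (1::real)" by (rule AE_lborel_singleton)
  ultimately have "AE t in lborel. ennreal (W t / t) * indicator {0<..1} t = 0"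
    by eventually_elim (auto split: split_indicator)
  then have "(\<integral>\<^sup>+t\<in>{0<..1}. ennreal (W t / t) \<partial>lborel) = (\<integral>\<^sup>+t. 0 \<partial>(lborel :: real measure))"
    by (intro nn_integral_cong_AE)
  then show False using C2 by (simp add: condition_C2_def)
qed

text \<open>Substituting t = 2u produces a factor 2; then 1 - 2u \<le> (1 - u)^2 doubles the
  exponent and W(2u) \<le> c W(u) restores the weight.\<close>

lemma moment_doubling:
  assumes c: "0 < c" "\<And>t. 0 < t \<Longrightarrow> t < 1 \<Longrightarrow> W t \<le> c * W (t / 2)"
  shows "moment W n \<le> 4 * (c / 2) * moment W (2 * n)"
proof -
  define f where "f t = indicator {0<..1} t *\<^sub>R ((1 - t) ^ n * W t)" for t :: real
  have f: "integrable lborel f" unfolding f_def by (rule moment_integrable)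
  have "moment W n = (LINT t|lborel. f t)" by (simp add: moment_alt f_def)
  also have "\<dots> = \<bar>2\<bar> *\<^sub>R (LINT u|lborel. f (0 + 2 * u))" by (rule lborel_integral_real_affine) simp
  also have "\<dots> = 2 * (LINT u|lborel. f (2 * u))" by simp
  also have "(LINT u|lborel. f (2 * u)) \<le> (LINT u|lborel. c * (indicator {0<..1} u *\<^sub>R ((1 - u) ^ (2 * n) * W u)))"
  proof (rule integral_mono_AE)
    show "integrable lborel (\<lambda>u. f (2 * u))"
      using lborel_integrable_real_affine[OF f, of 2 0] by simp
    show "integrable lborel (\<lambda>u. c * (indicator {0<..1} u *\<^sub>R ((1 - u) ^ (2 * n) * W u)))"
      by (intro integrable_mult_right moment_integrable)
    have "AE u in lborel. u \<noteq> (1/2::real)" by (rule AE_lborel_singleton)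
    then show "AE u in lborel. f (2 * u) \<le> c * (indicator {0<..1} u *\<^sub>R ((1 - u) ^ (2 * n) * W u))"
    proof eventually_elim
      case (elim u)
      show ?case
      proof (cases "0 < u \<and> u < 1/2")
        case True
        have "(1 - 2 * u) ^ n \<le> ((1 - u)\<^sup>2) ^ n"
          using True by (intro power_mono) (auto simp: power2_eq_square algebra_simps)
        also have "\<dots> = (1 - u) ^ (2 * n)" by (simp add: power_mult)
        finally have "(1 - 2 * u) ^ n * W (2 * u) \<le> (1 - u) ^ (2 * n) * (c * W u)"
          using True c(2)[of "2 * u"] weight_nonneg[of "2 * u"] by (intro mult_mono) auto
        then show ?thesis using True by (simp add: f_def mult_ac)
      next
        case False
        then have "f (2 * u) = 0" using elim by (auto simp: f_def split: split_indicator)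
        then show ?thesis using c(1) weight_nonneg[of u] by (auto split: split_indicator)
      qed
    qed
  qed
  finally show ?thesis by (simp add: moment_alt)
qed

text \<open>The kernel is the average, with density W(t), of Poisson kernels at (1 - t) r z. The
  argument runs on partial sums, whose lower bound tends to 0 as N grows.\<close>

lemma moment_kernel_positive:
  assumes r: "0 \<le> r" "r < 1" and z: "norm z \<le> 1"
  shows "0 \<le> Re (\<Sum>n. of_real ((if n = 0 then moment W 0 else 2 * moment W n) * r ^ n) * z ^ n)"
proof -
  define \<kappa> where "\<kappa> n = (if n = 0 then moment W 0 else 2 * moment W n) * r ^ n" for n
  have "summable (\<lambda>n. of_real (\<kappa> n) * z ^ n)"
  proof (rule summable_norm_cancel, rule summable_comparison_test')
    show "summable (\<lambda>n. 2 * moment W 0 * r ^ n)" using r by (intro summable_mult summable_geometric) auto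
    fix n :: nat
    have "\<kappa> n \<le> 2 * moment W 0 * r ^ n" "0 \<le> \<kappa> n"
      using decseqD[OF decseq_moment, of 0 n] moment_nonneg[of n] moment_nonneg[of 0] r
      by (auto simp: \<kappa>_def intro!: mult_right_mono)
    moreover have "norm (z ^ n) \<le> 1" using z by (simp add: norm_power power_le_one)
    ultimately show "norm (norm (of_real (\<kappa> n) * z ^ n)) \<le> 2 * moment W 0 * r ^ n"
      using mult_left_le[of "norm (z ^ n)" "\<kappa> n"] by (simp add: norm_mult)
  qed
  then have "(\<lambda>N. Re (\<Sum>n<N. of_real (\<kappa> n) * z ^ n)) \<longlonglongrightarrow> Re (\<Sum>n. of_real (\<kappa> n) * z ^ n)"
    by (intro tendsto_Re summable_LIMSEQ)
  moreover have "(\<lambda>N. - (2 * r ^ N / (1 - r)) * moment W 0) \<longlonglongrightarrow> - (2 * 0 / (1 - r)) * moment W 0"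
    using r by (intro tendsto_intros LIMSEQ_realpow_zero) auto
  moreover have "- (2 * r ^ N / (1 - r)) * moment W 0 \<le> Re (\<Sum>n<N. of_real (\<kappa> n) * z ^ n)" if "N \<ge> 1" for N
  proof -
    let ?c = "\<lambda>n::nat. if n = 0 then 1 else (2::real)"
    let ?I = "\<lambda>n t. indicator {0<..1} t *\<^sub>R ((1 - t) ^ n * W t)"
    define S where "S v = (\<Sum>n<N. (if n = 0 then 1 else 2) * v ^ n)" for v :: complex
    have ReS: "(\<Sum>n<N. ?c n * Re (z ^ n) * r ^ n * ?I n t) = Re (S (of_real ((1 - t) * r) * z)) * ?I 0 t" for t
    proof -
      have "Re (S (of_real s * z)) = (\<Sum>n<N. ?c n * Re (z ^ n) * s ^ n)" for s
        unfolding S_def Re_sum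
        by (intro sum.cong refl) (simp add: power_mult_distrib flip: of_real_power)
      then have "Re (S (of_real ((1 - t) * r) * z)) * ?I 0 t
          = (\<Sum>n<N. ?c n * Re (z ^ n) * ((1 - t) * r) ^ n * ?I 0 t)"
        by (simp only: sum_distrib_right)
      also have "\<dots> = (\<Sum>n<N. ?c n * Re (z ^ n) * r ^ n * ?I n t)"
        by (intro sum.cong refl) (simp add: power_mult_distrib)
      finally show ?thesis by (rule sym)
    qed
    have "Re (\<Sum>n<N. of_real (\<kappa> n) * z ^ n) = (\<Sum>n<N. ?c n * Re (z ^ n) * r ^ n * moment W n)"
      unfolding Re_sum by (intro sum.cong refl) (simp add: \<kappa>_def mult_ac)
    also have "\<dots> = (LINT t|lborel. (\<Sum>n<N. ?c n * Re (z ^ n) * r ^ n * ?I n t))"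
      unfolding moment_alt using moment_integrable by (subst Bochner_Integration.integral_sum) auto
    also have "\<dots> \<ge> (LINT t|lborel. - (2 * r ^ N / (1 - r)) * ?I 0 t)"
    proof (rule integral_mono)
      show "integrable lborel (\<lambda>t. - (2 * r ^ N / (1 - r)) * ?I 0 t)"
        by (intro integrable_mult_right moment_integrable)
      show "integrable lborel (\<lambda>t. \<Sum>n<N. ?c n * Re (z ^ n) * r ^ n * ?I n t)"
        by (intro Bochner_Integration.integrable_sum integrable_mult_right moment_integrable)
      fix t :: real
      show "- (2 * r ^ N / (1 - r)) * ?I 0 t \<le> (\<Sum>n<N. ?c n * Re (z ^ n) * r ^ n * ?I n t)"
      proof (cases "0 < t \<and> t \<le> 1")
        case True
        have "norm (of_real ((1 - t) * r) * z) = (1 - t) * r * norm z"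
          using True r by (simp only: norm_mult[of _ z] norm_of_real abs_of_nonneg mult_nonneg_nonneg diff_ge_0_iff_ge)
        also have "\<dots> \<le> 1 * r * 1" using True r z by (intro mult_mono) auto
        finally have "- (2 * r ^ N / (1 - r)) \<le> Re (S (of_real ((1 - t) * r) * z))"
          unfolding S_def using r that by (intro Re_geometric_kernel_ge) auto
        then show ?thesis unfolding ReS using weight_nonneg[of t] True by (intro mult_right_mono) auto
      qed auto
    qed
    finally show ?thesis unfolding moment_alt by simp
  qed
  ultimately have "- (2 * 0 / (1 - r)) * moment W 0 \<le> Re (\<Sum>n. of_real (\<kappa> n) * z ^ n)"
    by (intro LIMSEQ_le) auto
  then show ?thesis by (simp add: \<kappa>_def)
qed

lemma positive_kernel_moment:
  assumes "condition_C2 W" "condition_C3 W"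
  obtains \<rho> where "positive_kernel (moment W) \<rho>"
proof -
  obtain c where c: "0 < c" "c < 2" "\<forall>t. 0 < t \<and> t < 1 \<longrightarrow> W t \<le> c * W (t / 2)"
    using assms(2) by (auto simp: condition_C3_def)
  have "positive_kernel (moment W) (c / 2)"
  proof unfold_locales
    show "0 < moment W n" for n by (rule moment_pos[OF assms(1)])
    show "decseq (moment W)" by (rule decseq_moment)
    show "moment W n \<le> 4 * (c / 2) * moment W (2 * n)" for n
      using c by (intro moment_doubling) auto
    show "c / 2 < 1" using c by simp
  qed (rule moment_kernel_positive)
  then show thesis by (rule that)
qed

end

section \<open>Weak limits\<close>

lemma cis_measurable_circle: "cis \<in> measurable borel circle_borel"
  by (rule measurable_restrict_space2) (auto intro!: borel_measurable_continuous_onI continuous_intros)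

lemma weighted_l2_symmetric:
  assumes sym: "\<And>n. norm (a (- int n)) = norm (a (int n))"
    and s: "summable (\<lambda>n. (norm (a (int n)))\<^sup>2 * \<omega> n)" and \<omega>: "\<And>n. 0 \<le> \<omega> n"
  shows "a \<in> weighted_l2 \<omega>"
proof -
  let ?f = "\<lambda>n. (norm (a n))\<^sup>2 * \<omega> (nat \<bar>n\<bar>)"
  have nat: "(\<lambda>n. (norm (a (int n)))\<^sup>2 * \<omega> n) summable_on UNIV"
    using s \<omega> by (intro norm_summable_imp_summable_on) simp
  have "?f summable_on range int"
    using nat by (subst summable_on_reindex) (simp_all add: o_def)
  moreover have "?f summable_on range (\<lambda>n. - int n)"
    using nat by (subst summable_on_reindex) (simp_all add: o_def sym inj_on_def)
  moreover have "range int \<union> range (\<lambda>n. - int n) = UNIV"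
  proof -
    have "k \<in> range int \<union> range (\<lambda>n. - int n)" for k :: int
      by (cases k rule: int_cases2) auto
    then show ?thesis by blast
  qed
  ultimately have "?f summable_on UNIV"
    using summable_on_union[of ?f "range int" "range (\<lambda>n. - int n)"] by simp
  then show ?thesis by (simp add: weighted_l2_def)
qed

text \<open>Measures on the circle are transported to angles, where tight sequences of real
  distributions have weakly convergent subsequences, and the limit is transported back by
  \<open>cis\<close>. Finite energy survives by a Fatou argument on finitely many
  frequencies.\<close>

lemma (in positive_kernel) weak_limit_finite_energy:
  assumes E: "E \<subseteq> unit_circle" "compact E"
    and p: "\<And>k. p k \<in> finite_pmfs E" and r: "\<And>k. 0 < r k" "\<And>k. r k < 1" "r \<longlonglongrightarrow> 1"
    and en: "\<And>k::nat. energy (r k) (p k) \<le> M"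
  shows "\<exists>\<nu>. sets \<nu> = sets circle_borel \<and> prob_space \<nu> \<and> measure_support \<nu> \<subseteq> E \<and>
           fourier_coeff \<nu> \<in> weighted_l2 \<omega>"
proof -
  \<comment> \<open>Principal angles lie in (-pi, pi], so tightness is automatic. Mass that moves to
    the endpoint -pi in the limit is harmless, because all test functions are continuous functions
    of \<open>cis \<theta>\<close>.\<close>
  define \<mu> where "\<mu> k = distr (measure_pmf (p k)) borel Arg" for k
  have Arg_meas [measurable]: "Arg \<in> measurable (measure_pmf q) borel" for q by simp
  have rd: "real_distribution (\<mu> k)" for k
    unfolding \<mu>_def by (rule prob_space.real_distribution_distr[OF prob_space_measure_pmf]) simp
  have int_\<mu>: "(LINT \<theta>|\<mu> k. f \<theta>) = (LINT x|measure_pmf (p k). f (Arg x))"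
    if "f \<in> borel_measurable borel" for f :: "real \<Rightarrow> 'b::{banach, second_countable_topology}" and k
    unfolding \<mu>_def by (rule integral_distr[OF Arg_meas that])
  have cA: "cis (Arg x) = x" if "x \<in> E" for x
    using that E by (subst cis_Arg) (auto simp: sgn_eq)
  have AE_E: "AE x in measure_pmf (p k). x \<in> E" for k
    using p[of k] by (auto simp: AE_measure_pmf_iff finite_pmfs_def)
  have "tight \<mu>"
    unfolding tight_def
  proof (intro conjI allI impI)
    fix \<epsilon> :: real assume "0 < \<epsilon>"
    have "measure (\<mu> k) {-pi<..pi} = 1" for k
      unfolding \<mu>_def using Arg_bounded
      by (subst measure_distr) (auto simp: vimage_def measure_pmf.prob_space)
    then show "\<exists>a b. a < b \<and> (\<forall>n. 1 - \<epsilon> < measure (\<mu> n) {a<..b})"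
      using \<open>0 < \<epsilon>\<close> by (intro exI[of _ "-pi"] exI[of _ pi]) auto
  qed (rule rd)
  then obtain s N where s: "strict_mono (s :: nat \<Rightarrow> nat)" and N: "real_distribution N"
    and wc: "weak_conv_m (\<mu> \<circ> id \<circ> s) N"
    using tight_imp_convergent_subsubsequence[of \<mu> id] strict_mono_id by blast
  interpret N: real_distribution N by fact
  have conv: "(\<lambda>k. LINT \<theta>|\<mu> (s k). f \<theta>) \<longlonglongrightarrow> (LINT \<theta>|N. f \<theta>)"
    if c: "\<And>x. isCont f x" and b: "\<exists>B. \<forall>x. norm (f x) \<le> B" for f :: "real \<Rightarrow> 'b::{banach, second_countable_topology}"
  proof -
    obtain B where B: "\<forall>x. norm (f x) \<le> B" using b ..
    show ?thesis
      using weak_conv_imp_integral_bdd_continuous_conv[of "\<mu> \<circ> id \<circ> s" N f B, OF _ N wc c] rd B by simp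
  qed
  define m where "m n = (LINT \<theta>|N. cis (real n * \<theta>))" for n
  have m: "(\<lambda>k. pmf_moment (p (s k)) n) \<longlonglongrightarrow> m n" for n
  proof -
    have "(LINT \<theta>|\<mu> k. cis (real n * \<theta>)) = pmf_moment (p k) n" for k
    proof -
      have "(LINT \<theta>|\<mu> k. cis (real n * \<theta>)) = (LINT x|measure_pmf (p k). cis (real n * Arg x))"
        by (rule int_\<mu>) (intro borel_measurable_continuous_onI continuous_intros)
      also have "\<dots> = (LINT x|measure_pmf (p k). x ^ n)"
        using AE_E[of k] by (intro integral_cong_AE) (auto simp: cA simp flip: Complex.DeMoivre elim!: eventually_mono)
      finally show ?thesis by (simp add: pmf_moment_def)
    qed
    moreover have "(\<lambda>k. LINT \<theta>|\<mu> (s k). cis (real n * \<theta>)) \<longlonglongrightarrow> m n"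
      unfolding m_def 
    proof (rule conv)
      have "continuous_on UNIV (\<lambda>\<theta>. cis (real n * \<theta>))" by (intro continuous_intros)
      then show "isCont (\<lambda>\<theta>. cis (real n * \<theta>)) x" for x by (simp add: continuous_on_eq_continuous_at)
    qed (auto intro!: exI[of _ 1])
    ultimately show ?thesis by simp
  qed
  \<comment> \<open>A bounded continuous function that vanishes exactly at the angles of points of
    the closed set \<open>E\<close>. Its integral is 0 along the sequence, hence in the limit, which
    puts the limit on \<open>E\<close>.\<close>
  define d where "d \<theta> = min 1 (infdist (cis \<theta>) E)" for \<theta>
  have d: "continuous_on UNIV d" "\<And>\<theta>. 0 \<le> d \<theta>" "\<And>\<theta>. d \<theta> \<le> 1"
    by (auto simp: d_def infdist_nonneg intro!: continuous_intros)
  have dm: "d \<in> borel_measurable borel" using d(1) by (rule borel_measurable_continuous_onI)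
  have "(LINT \<theta>|\<mu> k. d \<theta>) = 0" for k
  proof -
    have "(LINT \<theta>|\<mu> k. d \<theta>) = (LINT x|measure_pmf (p k). d (Arg x))" by (rule int_\<mu>[OF dm])
    also have "\<dots> = (LINT x|measure_pmf (p k). 0)"
      using AE_E[of k] by (intro integral_cong_AE) (auto simp: cA d_def elim!: eventually_mono)
    finally show ?thesis by simp
  qed
  moreover have "(\<lambda>k. LINT \<theta>|\<mu> (s k). d \<theta>) \<longlonglongrightarrow> (LINT \<theta>|N. d \<theta>)"
    using d by (intro conv) (auto simp: continuous_on_eq_continuous_at intro!: exI[of _ 1])
  ultimately have d0: "(LINT \<theta>|N. d \<theta>) = 0" by (simp add: LIMSEQ_const_iff)
  have "E \<noteq> {}" using p[of 0] set_pmf_not_empty[of "p 0"] by (auto simp: finite_pmfs_def)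
  have "AE \<theta> in N. d \<theta> = 0"
    using d0 d dm
    by (subst (asm) integral_nonneg_eq_0_iff_AE) (auto intro!: N.integrable_const_bound[where B = 1])
  then have AE_N: "AE \<theta> in N. cis \<theta> \<in> E"
  proof (rule eventually_mono)
    fix \<theta> assume "d \<theta> = 0"
    then have "infdist (cis \<theta>) E = 0" by (simp add: d_def min_def split: if_splits)
    then show "cis \<theta> \<in> E"
      using in_closed_iff_infdist_zero[OF compact_imp_closed[OF E(2)] \<open>E \<noteq> {}\<close>] by simp
  qed
  have cm: "cis \<in> measurable N circle_borel"
    using cis_measurable_circle by (simp cong: measurable_cong_sets)
  define \<nu> where "\<nu> = distr N circle_borel cis"
  have "measure_support \<nu> \<subseteq> E"
  proof
    fix z assume z: "z \<in> measure_support \<nu>"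
    show "z \<in> E"
    proof (rule ccontr)
      assume "z \<notin> E"
      have "open (- E)" using E(2) by (simp add: compact_imp_closed open_Compl)
      then have "- E \<inter> unit_circle \<in> sets circle_borel"
        by (subst sets_restrict_space) (metis Int_commute borel_open image_eqI)
      then have "emeasure \<nu> (- E \<inter> unit_circle) = emeasure N (cis -` (- E \<inter> unit_circle) \<inter> space N)"
        unfolding \<nu>_def by (rule emeasure_distr[OF cm])
      also have "\<dots> = 0"
      proof -
        have "cis -` (- E \<inter> unit_circle) \<inter> space N = {\<theta> \<in> space N. cis \<theta> \<notin> E}" by auto
        then show ?thesis using AE_N emeasure_eq_0_AE[of "\<lambda>\<theta>. cis \<theta> \<notin> E" N] by simp
      qed
      finally show False
        using z \<open>z \<notin> E\<close> \<open>open (- E)\<close> unfolding measure_support_def by blast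
    qed
  qed
  moreover have "fourier_coeff \<nu> \<in> weighted_l2 \<omega>"
  proof (rule weighted_l2_symmetric)
    have fc: "fourier_coeff \<nu> k = (LINT \<theta>|N. cis \<theta> powi (- k))" for k
      unfolding fourier_coeff_def \<nu>_def by (rule integral_distr[OF cm measurable_circle_powi])
    have neg: "fourier_coeff \<nu> (- int n) = m n" for n
      unfolding fc m_def by (simp add: Complex.DeMoivre)
    have posn: "fourier_coeff \<nu> (int n) = cnj (m n)" for n
    proof -
      have "cis \<theta> powi (- int n) = cnj (cis (real n * \<theta>))" for \<theta>
        by (simp add: power_int_minus Complex.DeMoivre cis_cnj)
      then show ?thesis unfolding fc m_def by simp
    qed
    show "norm (fourier_coeff \<nu> (- int n)) = norm (fourier_coeff \<nu> (int n))" for n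
      unfolding neg posn by simp
    \<comment> \<open>With L fixed, only finitely many moments and powers r^n pass to the limit;
      afterwards L is free.\<close>
    have "(\<Sum>n<L. (norm (m n))\<^sup>2 * \<omega> n) \<le> M" for L
    proof -
      have "(\<lambda>k. \<Sum>n<L. (norm (pmf_moment (p (s k)) n))\<^sup>2 * (\<omega> n * r (s k) ^ n))
          \<longlonglongrightarrow> (\<Sum>n<L. (norm (m n))\<^sup>2 * (\<omega> n * 1 ^ n))"
        using LIMSEQ_subseq_LIMSEQ[OF r(3) s, unfolded o_def] m
        by (intro tendsto_intros)
      moreover have "(\<Sum>n<L. (norm (pmf_moment (p (s k)) n))\<^sup>2 * (\<omega> n * r (s k) ^ n)) \<le> M" for k
      proof -
        have "(\<Sum>n<L. (norm (pmf_moment (p (s k)) n))\<^sup>2 * (\<omega> n * r (s k) ^ n))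
            \<le> (\<Sum>n<L. kernel_coeff (r (s k)) n * (norm (pmf_moment (p (s k)) n))\<^sup>2)"
        proof (rule sum_mono)
          fix n
          have "\<omega> n * r (s k) ^ n \<le> kernel_coeff (r (s k)) n"
            using pos[of n] r(1)[of "s k"] by (auto simp: kernel_coeff_def)
          then show "(norm (pmf_moment (p (s k)) n))\<^sup>2 * (\<omega> n * r (s k) ^ n)
              \<le> kernel_coeff (r (s k)) n * (norm (pmf_moment (p (s k)) n))\<^sup>2"
            by (subst mult.commute) (rule mult_right_mono, auto)
        qed
        also have "\<dots> \<le> energy (r (s k)) (p (s k))"
          unfolding energy_def using r(1)[of "s k"]
          by (intro sum_le_suminf summable_energy[OF E(1) p] r) (auto intro!: mult_nonneg_nonneg kernel_coeff_nonneg)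
        also note en
        finally show ?thesis .
      qed
      ultimately have "(\<Sum>n<L. (norm (m n))\<^sup>2 * (\<omega> n * 1 ^ n)) \<le> M"
        by (intro LIMSEQ_le_const2) auto
      then show ?thesis by simp
    qed
    then show "summable (\<lambda>n. (norm (fourier_coeff \<nu> (int n)))\<^sup>2 * \<omega> n)"
      unfolding posn using pos by (intro summableI_nonneg_bounded[where x = M]) (auto simp: less_imp_le[OF pos])
    show "0 \<le> \<omega> n" for n using pos[of n] by simp
  qed
  moreover have "prob_space \<nu>" unfolding \<nu>_def by (rule N.prob_space_distr[OF cm])
  moreover have "sets \<nu> = sets circle_borel" by (simp add: \<nu>_def)
  ultimately show ?thesis by blast
qed

section \<open>Pairing with a complex measure\<close>

lemma (in positive_kernel) energy_unbounded:
  assumes E: "E \<subseteq> unit_circle" "compact E"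
    and none: "\<not> (\<exists>\<nu>. sets \<nu> = sets circle_borel \<and> prob_space \<nu> \<and> measure_support \<nu> \<subseteq> E \<and>
           fourier_coeff \<nu> \<in> weighted_l2 \<omega>)"
  obtains r where "0 < r" "r < 1" "\<And>p. p \<in> finite_pmfs E \<Longrightarrow> M \<le> energy r p"
proof (rule ccontr)
  assume "\<not> thesis"
  then have "\<exists>p\<in>finite_pmfs E. energy r p \<le> M" if "0 < r" "r < 1" for r
    using that(1,2) \<open>\<And>r. 0 < r \<Longrightarrow> r < 1 \<Longrightarrow> (\<And>p. p \<in> finite_pmfs E \<Longrightarrow> M \<le> energy r p) \<Longrightarrow> thesis\<close>
    by (meson linear)
  \<comment> \<open>The offset 2 keeps the first radius at 1/2, strictly positive.\<close>
  moreover define r where "r k = 1 - inverse (real (Suc (Suc k)))" for k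
  have r: "0 < r k" "r k < 1" for k by (auto simp: r_def field_simps)
  ultimately have "\<forall>k. \<exists>p. p \<in> finite_pmfs E \<and> energy (r k) p \<le> M" by blast
  then obtain p where p: "\<And>k. p k \<in> finite_pmfs E" "\<And>k. energy (r k) (p k) \<le> M" by metis
  have "r \<longlonglongrightarrow> 1 - 0"
    unfolding r_def by (intro tendsto_diff tendsto_const LIMSEQ_Suc[OF LIMSEQ_inverse_real_of_nat])
  then have "r \<longlonglongrightarrow> 1" by simp
  from none weak_limit_finite_energy[OF E p(1) r this p(2)] show False by (rule notE)
qed

lemma norm_suminf_mult_le:
  fixes a b :: "nat \<Rightarrow> complex" and w :: "nat \<Rightarrow> real"
  assumes w: "\<And>n. 0 < w n"
    and a: "summable (\<lambda>n. (norm (a n))\<^sup>2 / w n)" and b: "summable (\<lambda>n. (norm (b n))\<^sup>2 * w n)"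
    and s: "(\<lambda>n. a n * b n) sums S"
  shows "norm S \<le> sqrt (\<Sum>n. (norm (a n))\<^sup>2 / w n) * sqrt (\<Sum>n. (norm (b n))\<^sup>2 * w n)"
proof (rule LIMSEQ_le_const2)
  show "(\<lambda>N. norm (\<Sum>n<N. a n * b n)) \<longlonglongrightarrow> norm S"
    using s unfolding sums_def by (rule tendsto_norm)
  have "norm (\<Sum>n<N. a n * b n) \<le> sqrt (\<Sum>n. (norm (a n))\<^sup>2 / w n) * sqrt (\<Sum>n. (norm (b n))\<^sup>2 * w n)" for N
  proof -
    have "norm (\<Sum>n<N. a n * b n) \<le> (\<Sum>n<N. (norm (a n) / sqrt (w n)) * (norm (b n) * sqrt (w n)))"
      by (rule order_trans[OF norm_sum]) (use w in \<open>simp add: norm_mult less_imp_neq[THEN not_sym]\<close>)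
    also have "\<dots> \<le> sqrt ((\<Sum>n<N. (norm (a n) / sqrt (w n))\<^sup>2) * (\<Sum>n<N. (norm (b n) * sqrt (w n))\<^sup>2))"
      by (intro real_le_rsqrt Cauchy_Schwarz_ineq_sum)
    also have "\<dots> = sqrt (\<Sum>n<N. (norm (a n))\<^sup>2 / w n) * sqrt (\<Sum>n<N. (norm (b n))\<^sup>2 * w n)"
      using w by (simp add: real_sqrt_mult power_divide power_mult_distrib less_imp_le)
    also have "\<dots> \<le> sqrt (\<Sum>n. (norm (a n))\<^sup>2 / w n) * sqrt (\<Sum>n. (norm (b n))\<^sup>2 * w n)"
      using a b by (intro mult_mono real_sqrt_le_mono sum_le_suminf)
        (auto intro!: sum_nonneg suminf_nonneg simp: less_imp_le[OF w])
    finally show ?thesis .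
  qed
  then show "\<exists>N. \<forall>n\<ge>N. norm (\<Sum>n<n. a n * b n) \<le> sqrt (\<Sum>n. (norm (a n))\<^sup>2 / w n) * sqrt (\<Sum>n. (norm (b n))\<^sup>2 * w n)"
    by blast
qed

text \<open>Multiplying \<open>\<mu>\<close> by a power of z preserves the hypothesis. Raising the
  shift by one pairs a term with the weight of the preceding index, which doubling controls as n + 1
  \<le> 2n for n \<ge> 1. Lowering it pairs a term with a smaller weight and adds a single new
  term.\<close>

lemma (in doubling_weight) summable_shift:
  fixes u :: "int \<Rightarrow> real"
  assumes u: "\<And>k. 0 \<le> u k" and s: "summable (\<lambda>n. u (int (Suc n)) * \<omega> (Suc n))"
  shows "summable (\<lambda>n. u (int (Suc n) + k) * \<omega> (Suc n))"
proof (induction k rule: int_induct[where k = 0])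
  case base
  then show ?case using s by simp
next
  case (step1 k)
  have "summable (\<lambda>n. 4 * \<rho> * (u (int (Suc (Suc n)) + k) * \<omega> (Suc (Suc n))))"
    using step1(2) by (intro summable_mult) (subst summable_Suc_iff[where f = "\<lambda>n. u (int (Suc n) + k) * \<omega> (Suc n)"])
  then show ?case
  proof (rule summable_comparison_test')
    fix n :: nat
    have "\<omega> (Suc n) \<le> 4 * \<rho> * \<omega> (2 * Suc n)" by (rule doubling)
    also have "\<dots> \<le> 4 * \<rho> * \<omega> (Suc (Suc n))"
      using rho_pos by (intro mult_left_mono decseqD[OF dec]) auto
    finally have "u (int (Suc (Suc n)) + k) * \<omega> (Suc n) \<le> u (int (Suc (Suc n)) + k) * (4 * \<rho> * \<omega> (Suc (Suc n)))"
      using u by (rule mult_left_mono)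
    moreover have "int (Suc n) + (k + 1) = int (Suc (Suc n)) + k" by simp
    ultimately show "norm (u (int (Suc n) + (k + 1)) * \<omega> (Suc n)) \<le> 4 * \<rho> * (u (int (Suc (Suc n)) + k) * \<omega> (Suc (Suc n)))"
      using u[of "int (Suc (Suc n)) + k"] pos[of "Suc n"] by (simp only: real_norm_def abs_of_nonneg mult_nonneg_nonneg less_imp_le mult_ac)
  qed
next
  case (step2 k)
  have "summable (\<lambda>n. u (int (Suc (Suc n)) + (k - 1)) * \<omega> (Suc (Suc n)))"
  proof (rule summable_comparison_test'[OF step2(2)])
    fix n :: nat
    have "u (int (Suc n) + k) * \<omega> (Suc (Suc n)) \<le> u (int (Suc n) + k) * \<omega> (Suc n)"
      using u decseqD[OF dec, of "Suc n" "Suc (Suc n)"] by (intro mult_left_mono) auto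
    moreover have "int (Suc (Suc n)) + (k - 1) = int (Suc n) + k" by simp
    ultimately show "norm (u (int (Suc (Suc n)) + (k - 1)) * \<omega> (Suc (Suc n))) \<le> u (int (Suc n) + k) * \<omega> (Suc n)"
      using u[of "int (Suc n) + k"] pos[of "Suc (Suc n)"] by (simp only: real_norm_def abs_of_nonneg mult_nonneg_nonneg less_imp_le)
  qed
  then show ?case by (subst (asm) summable_Suc_iff[where f = "\<lambda>n. u (int (Suc n) + (k - 1)) * \<omega> (Suc n)"])
qed

section \<open>Integration against a complex measure supported in E\<close>

context
  fixes \<mu> :: "complex set \<Rightarrow> complex" and E :: "complex set"
  assumes \<mu>: "complex_measure circle_borel \<mu>" and E: "complex_support \<mu> \<subseteq> E" "compact E"
begin

text \<open>Numbering the four signed measures behind \<open>complex_measure_integral\<close> lets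
  claims be proved for all indices at once; every index from 3 on stands for the last one.\<close>

definition component :: "nat \<Rightarrow> complex set \<Rightarrow> real" where
  "component j A = (if j = 0 then Re (\<mu> A) else if j = 1 then - Re (\<mu> A)
     else if j = 2 then Im (\<mu> A) else - Im (\<mu> A))"

abbreviation part :: "nat \<Rightarrow> complex measure" where
  "part j \<equiv> positive_part circle_borel (component j)"

lemma component_eqs:
  "component 0 = (\<lambda>A. Re (\<mu> A))" "component 1 = (\<lambda>A. - Re (\<mu> A))"
  "component 2 = (\<lambda>A. Im (\<mu> A))" "component 3 = (\<lambda>A. - Im (\<mu> A))"
  by (simp_all add: component_def fun_eq_iff)

definition unit_coeff :: "nat \<Rightarrow> complex" where
  "unit_coeff j = (if j = 0 then 1 else if j = 1 then -1 else if j = 2 then \<i> else - \<i>)"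

lemma complex_measure_integral_parts:
  "complex_measure_integral circle_borel \<mu> f = (\<Sum>j<4. unit_coeff j * (LINT z|part j. f z))"
proof -
  have "{..<4::nat} = {0, 1, 2, 3}" by auto
  then show ?thesis
    unfolding complex_measure_integral_def component_eqs[symmetric]
    by (simp add: unit_coeff_def algebra_simps)
qed

lemma part_additive: "countably_additive_on circle_borel (component j)"
proof -
  have "countably_additive_on circle_borel (\<lambda>A. Re (\<mu> A))" "countably_additive_on circle_borel (\<lambda>A. Im (\<mu> A))"
    using \<mu> by (simp_all add: complex_measure_iff_Re_Im)
  note ca = this this[THEN countably_additive_on_uminus]
  show ?thesis
    unfolding component_def[abs_def] by (cases "j = 0"; cases "j = 1"; cases "j = 2"; simp add: ca)
qed

lemma finite_part: "finite_measure (part j)" for j :: nat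
  by (rule finite_measure_positive_part[OF part_additive])

lemma AE_part: "AE z in part j. z \<in> E" for j :: nat
proof (rule AE_I[where N = "unit_circle - E"])
  have "unit_circle \<inter> (- E) \<in> sets circle_borel"
    using E(2) unfolding sets_restrict_space by (intro imageI) (auto intro!: borel_open simp: compact_imp_closed open_Compl)
  then show m: "unit_circle - E \<in> sets (part j)" by (simp add: Diff_eq)
  show "emeasure (part j) (unit_circle - E) = 0"
    using m complex_support_null[OF \<mu> E(1)]
    by (intro emeasure_positive_part_eq_0[OF part_additive]) (auto simp: component_def)
qed auto

text \<open>Takes the place of the total variation norm in bounding integrals.\<close>

definition mass :: real where
  "mass = (\<Sum>j<4. measure (part j) unit_circle)"

lemma norm_unit_coeff: "norm (unit_coeff j) = 1"
  by (simp add: unit_coeff_def)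

text \<open>The bound B provides integrability; the size of the result is governed by d, because all
  four parts are concentrated on \<open>E\<close>.\<close>

lemma norm_integral_le:
  assumes f: "f \<in> borel_measurable circle_borel" "\<And>z. z \<in> unit_circle \<Longrightarrow> norm (f z) \<le> B"
    and d: "\<And>z. z \<in> E \<Longrightarrow> norm (f z) \<le> d"
  shows "norm (complex_measure_integral circle_borel \<mu> f) \<le> d * mass"
proof -
  have "norm (LINT z|part j. f z) \<le> d * measure (part j) unit_circle" for j :: nat
  proof -
    interpret finite_measure "part j" by (rule finite_part)
    have i: "integrable (part j) f"
      by (rule circle_integrable[OF finite_part _ f]) auto
    have "norm (LINT z|part j. f z) \<le> (LINT z|part j. norm (f z))" by (rule integral_norm_bound)
    also have "\<dots> \<le> (LINT z|part j. d)"
      using i AE_part[of j] d by (intro integral_mono_AE) (auto elim!: eventually_mono)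
    finally show ?thesis by (simp add: mult.commute)
  qed
  then have "(\<Sum>j<4. norm (unit_coeff j * (LINT z|part j. f z))) \<le> (\<Sum>j<4. d * measure (part j) unit_circle)"
    by (intro sum_mono) (simp add: norm_mult norm_unit_coeff)
  then show ?thesis
    unfolding complex_measure_integral_parts mass_def sum_distrib_left
    by (rule order_trans[OF norm_sum])
qed

text \<open>Powers have modulus 1 on the circle, so the absolutely summable coefficients permit
  termwise integration against each part. Conjugating the analytic series makes all frequencies of
  \<open>\<mu>\<close> that occur at least k.\<close>

lemma integral_power_series_sums:
  fixes a :: "nat \<Rightarrow> complex"
  assumes a: "summable (\<lambda>n. norm (a n))"
  shows "(\<lambda>n. cnj (a n) * complex_fourier_coeff \<mu> (int n + k)) sums
     complex_measure_integral circle_borel \<mu> (\<lambda>z. \<Sum>n. cnj (a n) * z powi (- (int n + k)))"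
proof -
  have "(\<lambda>n. LINT z|part j. cnj (a n) * z powi (- (int n + k))) sums
      (LINT z|part j. (\<Sum>n. cnj (a n) * z powi (- (int n + k))))" for j :: nat
  proof (rule sums_integral)
    interpret finite_measure "part j" by (rule finite_part)
    show int: "integrable (part j) (\<lambda>z. cnj (a n) * z powi (- (int n + k)))" for n
      by (intro integrable_mult_right circle_integrable[OF finite_part, where B = 1])
         (auto simp: norm_circle_powi measurable_circle_powi simp del: minus_add_distrib)
    show "AE z in part j. summable (\<lambda>n. norm (cnj (a n) * z powi (- (int n + k))))"
      using a by (intro AE_I2) (simp add: norm_mult norm_circle_powi del: minus_add_distrib)
    show "summable (\<lambda>n. LINT z|part j. norm (cnj (a n) * z powi (- (int n + k))))"
    proof -
      have "(LINT z|part j. norm (cnj (a n) * z powi (- (int n + k)))) = (LINT z|part j. norm (a n))" for n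
        by (intro Bochner_Integration.integral_cong) (auto simp: norm_mult norm_circle_powi simp del: minus_add_distrib)
      then show ?thesis using a by (simp add: summable_mult)
    qed
  qed
  then have "(\<lambda>n. \<Sum>j<4. unit_coeff j * (LINT z|part j. cnj (a n) * z powi (- (int n + k)))) sums
     complex_measure_integral circle_borel \<mu> (\<lambda>z. \<Sum>n. cnj (a n) * z powi (- (int n + k)))"
    unfolding complex_measure_integral_parts by (intro sums_sum sums_mult)
  then show ?thesis
    by (simp add: complex_fourier_coeff_def complex_measure_integral_parts sum_distrib_left mult_ac del: minus_add_distrib)
qed

text \<open>The four parts are positive measures, so their coefficients satisfy a conjugation
  symmetry that separates the real from the imaginary component. Each component then has equal
  positive and negative parts.\<close>

lemma fourier_coeff_zero_imp_zero:
  assumes "\<And>k. complex_fourier_coeff \<mu> k = 0" and A: "A \<in> sets circle_borel"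
  shows "\<mu> A = 0"
proof -
  define u where "u j k = (LINT z|part j. z powi k)" for j :: nat and k
  have four: "{..<4::nat} = {0, 1, 2, 3}" by auto
  have z: "(u 0 k - u 1 k) + \<i> * (u 2 k - u 3 k) = 0" for k
    using assms(1)[of "- k"]
    by (simp add: complex_fourier_coeff_def complex_measure_integral_parts u_def unit_coeff_def four algebra_simps)
  have cu: "u j (- k) = cnj (u j k)" for j k
  proof -
    have "z powi (- k) = cnj (z powi k)" if "z \<in> unit_circle" for z :: complex
    proof -
      have "inverse z = cnj z" using that by (rule circle_inverse)
      then show ?thesis by (simp add: power_int_minus flip: power_int_inverse)
    qed
    then have "u j (- k) = (LINT z|part j. cnj (z powi k))"
      unfolding u_def by (intro Bochner_Integration.integral_cong) auto
    then show ?thesis unfolding u_def Bochner_Integration.integral_cnj .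
  qed
  \<comment> \<open>Conjugating the relation at -k restores the index k but changes the sign of the
    imaginary unit; adding the two relations isolates the real component.\<close>
  have z': "(u 0 k - u 1 k) - \<i> * (u 2 k - u 3 k) = 0" for k
    using arg_cong[OF z[of "- k"], of cnj] by (simp add: cu)
  have "u 0 k = u 1 k" "u 2 k = u 3 k" for k
  proof -
    have "2 * (u 0 k - u 1 k) = ((u 0 k - u 1 k) + \<i> * (u 2 k - u 3 k)) + ((u 0 k - u 1 k) - \<i> * (u 2 k - u 3 k))"
      by simp
    also have "\<dots> = 0" by (simp only: z z' add_0_left)
    finally show "u 0 k = u 1 k" by simp
    then show "u 2 k = u 3 k" using z[of k] by simp
  qed
  then have "part 0 = part 1" "part 2 = part 3"
    by (intro finite_circle_measure_eqI finite_part; simp only: u_def sets_positive_part)+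
  note parts = this[unfolded component_eqs]
  then show ?thesis
    using Jordan_decomposition[OF part_additive[of 0] A] Jordan_decomposition[OF part_additive[of 2] A]
    unfolding component_eqs parts by (simp add: complex_eq_iff)
qed

end

section \<open>Contradiction: all Fourier coefficients of the given measure vanish\<close>

theorem theorem2p2:
  fixes W :: "real \<Rightarrow> real" and E :: "complex set" and \<mu> :: "complex set \<Rightarrow> complex"
  assumes "weight W" and "condition_C1 W" and "condition_C2 W" and "condition_C3 W"
    and "compact E" and "E \<subseteq> unit_circle"
    and "complex_measure circle_borel \<mu>"
    and "\<exists>A\<in>sets circle_borel. \<mu> A \<noteq> 0"
    and "complex_support \<mu> \<subseteq> E"
    and "(\<lambda>n::nat. (norm (complex_fourier_coeff \<mu> (int n)))\<^sup>2 * moment W n) summable_on {0<..}"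
  shows "\<exists>\<nu>. sets \<nu> = sets circle_borel \<and> prob_space \<nu> \<and> measure_support \<nu> \<subseteq> E \<and>
           fourier_coeff \<nu> \<in> weighted_l2 (moment W)"
proof (rule ccontr)
  assume none: "\<not> ?thesis"
  obtain \<rho> where "positive_kernel (moment W) \<rho>"
    using positive_kernel_moment[OF assms(1,3,4)] .
  then interpret positive_kernel "moment W" \<rho> .
  note \<mu> = assms(7,9,5)
  obtain A where A: "A \<in> sets circle_borel" "\<mu> A \<noteq> 0" using assms(8) by blast
  \<comment> \<open>If \<open>E\<close> were empty, every Borel subset of the circle would lie off
    the support and \<open>\<mu>\<close> would be zero.\<close>
  have "E \<noteq> {}"
    using complex_support_null[OF assms(7,9) A(1)] A sets.sets_into_space[OF A(1)] by auto
  define c where "c = complex_fourier_coeff \<mu>"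
  have "(\<lambda>n. (norm (c (int n)))\<^sup>2 * moment W n) summable_on range Suc"
    using assms(10) by (simp add: c_def greaterThan_0)
  then have "(\<lambda>n. (norm (c (int (Suc n))))\<^sup>2 * moment W (Suc n)) summable_on UNIV"
    by (subst (asm) summable_on_reindex) (auto simp: o_def)
  then have "summable (\<lambda>n. (norm (c (int (Suc n))))\<^sup>2 * moment W (Suc n))"
    by (rule summable_on_imp_summable)
  then have shift: "summable (\<lambda>n. (norm (c (int (Suc n) + k)))\<^sup>2 * moment W (Suc n))" for k
    by (intro summable_shift[where u = "\<lambda>k. (norm (c k))\<^sup>2"]) auto
  have "c k = 0" for k
  proof -
    define S where "S = (\<Sum>n. (norm (c (int (Suc n) + k)))\<^sup>2 * moment W (Suc n))"
    define D where "D = sqrt (512 * dirichlet_const) * sqrt S"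
    have S0: "0 \<le> S" unfolding S_def using shift by (intro suminf_nonneg) (auto simp: less_imp_le[OF pos])
    \<comment> \<open>N is the exponent in g, and the energies are made at least N^4. The dual norm
      of the tail is then at most a constant times sqrt (N^2 / N^4) = 1/N, and the constant term of
      h contributes at most N * 2 \<omega>(0) / N^4 to the exponent.\<close>
    have est: "exp (- (2 * moment W 0 / N ^ 3)) * norm (c k) \<le> exp (- N) * mass \<mu> + D / N" if N: "0 < N" for N :: real
    proof -
      obtain r where r: "0 < r" "r < 1" and low: "\<And>p. p \<in> finite_pmfs E \<Longrightarrow> N ^ 4 \<le> energy r p"
        using energy_unbounded[OF assms(6,5) none, of "N ^ 4"] by blast
      have N4: "0 < N ^ 4" using N by simp
      obtain a \<beta> where a: "summable (\<lambda>n. norm (a n))"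
        and aE: "\<And>x. x \<in> E \<Longrightarrow> norm (\<Sum>n. a n * x ^ n) \<le> exp (- N)"
        and a0: "a 0 = of_real (exp (- N * \<beta>))" and \<beta>: "0 \<le> \<beta>" "\<beta> \<le> 2 * moment W 0 / N ^ 4"
        and sa: "summable (\<lambda>n. (norm (a (Suc n)))\<^sup>2 / moment W (Suc n))"
        and sa': "(\<Sum>n. (norm (a (Suc n)))\<^sup>2 / moment W (Suc n)) \<le> 512 * N\<^sup>2 * dirichlet_const / N ^ 4"
        using exists_test_series[OF assms(6) \<open>E \<noteq> {}\<close> r N4 low less_imp_le[OF N]] by blast
      \<comment> \<open>On the circle this is the conjugate of g times z^(-k). The series form is
        kept for measurability and termwise integration.\<close>
      define F where "F z = (\<Sum>n. cnj (a n) * z powi (- (int n + k)))" for z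
      have F: "(\<lambda>n. cnj (a n) * c (int n + k)) sums complex_measure_integral circle_borel \<mu> F"
        unfolding c_def F_def by (rule integral_power_series_sums[OF \<mu> a])
      have F_eq: "F z = cnj (\<Sum>n. a n * z ^ n) * z powi (- k)" if z: "z \<in> unit_circle" for z
      proof -
        have s: "summable (\<lambda>n. a n * z ^ n)"
          by (rule summable_norm_cancel) (use a z in \<open>simp add: norm_mult norm_power\<close>)
        have T: "cnj (a n) * z powi (- (int n + k)) = cnj (a n * z ^ n) * z powi (- k)" for n
        proof -
          have "inverse z = cnj z" using z by (rule circle_inverse)
          moreover have "z powi (- (int n + k)) = z powi (- int n) * z powi (- k)"
            using circle_powi_add[OF z, of "- int n" "- k"] by simp
          ultimately show ?thesis by (simp add: power_int_minus flip: power_inverse)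
        qed
        have "F z = (\<Sum>n. cnj (a n * z ^ n) * z powi (- k))" unfolding F_def T ..
        also have "\<dots> = (\<Sum>n. cnj (a n * z ^ n)) * z powi (- k)"
          by (rule suminf_mult2[symmetric, OF bounded_linear.summable[OF bounded_linear_cnj s]])
        also have "(\<Sum>n. cnj (a n * z ^ n)) = cnj (\<Sum>n. a n * z ^ n)"
          by (rule bounded_linear.suminf[OF bounded_linear_cnj s, symmetric])
        finally show ?thesis .
      qed
      have "norm (complex_measure_integral circle_borel \<mu> F) \<le> exp (- N) * mass \<mu>"
      proof (rule norm_integral_le[OF \<mu>])
        show "F \<in> borel_measurable circle_borel"
          unfolding F_def by (intro borel_measurable_suminf borel_measurable_times borel_measurable_const measurable_circle_powi)
        show "norm (F z) \<le> (\<Sum>n. norm (a n))" if z: "z \<in> unit_circle" for z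
        proof -
          have "norm (F z) = norm (\<Sum>n. a n * z ^ n)"
            unfolding F_eq[OF z] by (simp add: norm_mult norm_circle_powi[OF z])
          also have "\<dots> \<le> (\<Sum>n. norm (a n * z ^ n))"
            using a z by (intro summable_norm) (simp add: norm_mult norm_power)
          finally show ?thesis using z by (simp add: norm_mult norm_power)
        qed
        show "norm (F z) \<le> exp (- N)" if z: "z \<in> E" for z
        proof -
          have zc: "z \<in> unit_circle" using z assms(6) by blast
          show ?thesis unfolding F_eq[OF zc] using aE[OF z] by (simp add: norm_mult norm_circle_powi[OF zc])
        qed
      qed
      \<comment> \<open>Splitting off the term n = 0 isolates the wanted coefficient c k, multiplied
        by the conjugate of g(0). The remaining terms involve the shifted frequencies, for which
        weighted Cauchy-Schwarz is available.\<close>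
      moreover have tail: "(\<lambda>n. cnj (a (Suc n)) * c (int (Suc n) + k)) sums
          (complex_measure_integral circle_borel \<mu> F - cnj (a 0) * c k)"
        using F by (subst sums_Suc_iff) simp
      moreover have "norm (complex_measure_integral circle_borel \<mu> F - cnj (a 0) * c k) \<le> D / N"
      proof -
        have "norm (complex_measure_integral circle_borel \<mu> F - cnj (a 0) * c k)
            \<le> sqrt (\<Sum>n. (norm (a (Suc n)))\<^sup>2 / moment W (Suc n)) * sqrt S"
          using norm_suminf_mult_le[of "\<lambda>n. moment W (Suc n)" "\<lambda>n. cnj (a (Suc n))", OF pos _ shift tail] sa
          by (simp add: S_def)
        also have "\<dots> \<le> sqrt (512 * N\<^sup>2 * dirichlet_const / N ^ 4) * sqrt S"
          using sa' S0 by (intro mult_right_mono real_sqrt_le_mono) auto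
        also have "512 * N\<^sup>2 * dirichlet_const / N ^ 4 = 512 * dirichlet_const / N\<^sup>2"
          using N by (simp add: field_simps power2_eq_square eval_nat_numeral)
        also have "sqrt (512 * dirichlet_const / N\<^sup>2) * sqrt S = D / N"
          using N by (simp add: D_def real_sqrt_divide)
        finally show ?thesis .
      qed
      ultimately have "norm (cnj (a 0) * c k) \<le> exp (- N) * mass \<mu> + D / N"
        using norm_triangle_ineq4[of "complex_measure_integral circle_borel \<mu> F" "complex_measure_integral circle_borel \<mu> F - cnj (a 0) * c k"]
        by simp
      moreover have "exp (- (2 * moment W 0 / N ^ 3)) \<le> norm (a 0)"
      proof -
        have "N * \<beta> \<le> N * (2 * moment W 0 / N ^ 4)" using \<beta> N by (intro mult_left_mono) auto
        also have "\<dots> = 2 * moment W 0 / N ^ 3" using N by (simp add: field_simps eval_nat_numeral)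
        finally show ?thesis by (simp add: a0)
      qed
      ultimately show ?thesis
        using mult_right_mono[of "exp (- (2 * moment W 0 / N ^ 3))" "norm (a 0)" "norm (c k)"] by (simp add: norm_mult)
    qed
    have "((\<lambda>N. exp (- (2 * moment W 0 / N ^ 3)) * norm (c k)) \<longlongrightarrow> exp (- 0) * norm (c k)) at_top"
      by (intro tendsto_intros tendsto_divide_0[OF tendsto_const] filterlim_at_top_imp_at_infinity
          filterlim_pow_at_top filterlim_ident) simp
    moreover have "((\<lambda>N. exp (- N) * mass \<mu> + D / N) \<longlongrightarrow> 0 * mass \<mu> + 0) at_top"
      by (intro tendsto_intros tendsto_divide_0[OF tendsto_const] filterlim_at_top_imp_at_infinity filterlim_ident
          filterlim_compose[OF exp_at_bot filterlim_uminus_at_bot_at_top])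
    moreover have "eventually (\<lambda>N. exp (- (2 * moment W 0 / N ^ 3)) * norm (c k) \<le> exp (- N) * mass \<mu> + D / N) at_top"
      using eventually_gt_at_top[of 0] by eventually_elim (rule est)
    ultimately have "exp (- 0) * norm (c k) \<le> 0 * mass \<mu> + 0" by (intro tendsto_le[OF trivial_limit_at_top_linorder])
    then show ?thesis by simp
  qed
  then have "\<mu> A = 0" by (intro fourier_coeff_zero_imp_zero[OF \<mu> _ A(1)]) (simp add: c_def)
  with A(2) show False by simp
qed

end
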